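(* Let $p(z,t)$, $z\in\mathbb D$, $0\le t<T$, be such that $p(\cdot,t)$ belongs to the Carathéodory class for every $t\in[0,T)$, $p(\cdot,t)$ is $C^2$ in $\overline{\mathbb D}$ for $0\le t<T$, $p(z,\cdot)$ is continuous on $[0,T)$ for every $z\in\overline{\mathbb D}$, and $p(z,t)$, $p'(z,t)$, $p''(z,t)$ are bounded on $\overline{\mathbb D}\times[0,T)$. Let $f(z,t)$ be the solution of the Löwner–Kufarev equation $$\frac{\partial f(z,t)}{\partial t}=-z\frac{\partial f(z,t)}{\partial z}\,p(z,t),\qquad z\in\mathbb D,\ 0\le t<T,$$ with $f(z,0)=z$ (so $\Omega(0)=\mathbb D$), and put $\Omega(t)=f(\mathbb D,t)$, $\Gamma(t)=\partial\Omega(t)$. For each $t$ let $F(\cdot,\tau(t))$ be the conformal map of $\mathbb D^*=\{|z|>1\}$ onto the unbounded complementary component of $\Gamma(t)$ with $F(\infty,\tau(t))=\infty$ and expansion $F(z,\tau(t))=e^{-\tau(t)}z+b_0+b_1z^{-1}+\dots$ near $\infty$ (so $F(\mathbb T,\tau(t))=f(\mathbb T,t)=\Gamma(t)$). Let the conformal welding $\varphi=\varphi(\tilde\varphi)$ of $\Gamma(t)$ be defined by $f(e^{i\varphi},t)=F(e^{i\tilde\varphi},\tau(t))$ (both maps extended continuously to $\mathbb T$, with arguments chosen continuously so that $\varphi\to\tilde\varphi$ as $t\to0$). Then $$\varphi=\tilde\varphi+2\,\operatorname{Im} p(e^{i\tilde\varphi},0)\,t+o(t),\qquad t\to+0.$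$
   Context: $\mathbb D=\{|z|<1\}$, $\mathbb T=\partial\mathbb D$, $\mathbb D^*=\{|z|>1\}$. A function $p(\cdot,t)$ is in the Carathéodory class if it is analytic in $\mathbb D$, $p(z,t)=1+p_1(t)z+p_2(t)z^2+\dots$ and $\operatorname{Re}p(z,t)>0$ in $\mathbb D$. "$p(\cdot,t)$ is $C^2$ in $\overline{\mathbb D}$" means $p(\cdot,t)$ and its $z$-derivatives $p',p''$ extend continuously to $\overline{\mathbb D}$; primes denote derivatives in $z$. The solution $f(\cdot,t)$ maps $\mathbb D$ conformally onto $\Omega(t)\subset\mathbb D$, with $f(0,t)=0$, $f'(0,t)=e^{-t}$. *)

theory Defs
  imports "HOL-Analysis.Analysis"
begin

definition caratheodory :: "(complex \<Rightarrow> complex) \<Rightarrow> bool" where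
  "caratheodory g \<longleftrightarrow> g holomorphic_on ball 0 1 \<and> g 0 = 1 \<and> (\<forall>z\<in>ball 0 1. Re (g z) > 0)"

definition C2_closed_disc :: "(complex \<Rightarrow> complex) \<Rightarrow> bool" where
  "C2_closed_disc g \<longleftrightarrow> g holomorphic_on ball 0 1 \<and> continuous_on (cball 0 1) g \<and>
     (\<exists>g1 g2. continuous_on (cball 0 1) g1 \<and> continuous_on (cball 0 1) g2 \<and>
        (\<forall>z\<in>ball 0 1. g1 z = deriv g z \<and> g2 z = deriv (deriv g) z))"

end

theory Submission
  imports Defs "HOL-Complex_Analysis.Complex_Analysis"
begin

text \<open>
  Write \<open>f(z,t) = z e\<^bsup>q(z)\<^esup>\<close> on the unit circle and \<open>F(z,\<tau>(t)) = z exp (cnj (L z))\<close>, where \<open>L\<close> is holomorphic in the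
  \<^emph>\<open>inner\<close> disc, by reflection. A two-point maximum principle for the Loewner-Kufarev equation shows that
  \<open>f(z,t) - z\<close> has Lipschitz constant \<open>O(t)\<close> up to the boundary, and then \<open>q = - t p(z,0) + o(t)\<close> uniformly on the
  circle, with Lipschitz constant \<open>O(t)\<close>.

  On the circle \<open>Re L\<close> is \<open>Re q\<close> at the welded point. So the difference \<open>\<Delta>\<close> of \<open>L\<close> under a small rotation by \<open>h\<close>
  satisfies \<open>|Re \<Delta>| \<le> O(t) |h - Im \<Delta>|\<close>, and since \<open>\<integral>(Re \<Delta>)\<^sup>2 = \<integral>(Im \<Delta>)\<^sup>2\<close> this gives \<open>\<integral>|\<Delta>|\<^sup>2 = O(t\<^sup>2h\<^sup>2)\<close>:
  the Dirichlet seminorm \<open>\<Sum>n\<^sup>2|a\<^sub>n|\<^sup>2\<close> of \<open>L\<close> is \<open>O(t\<^sup>2)\<close>. The real part of \<open>E = L + t p(z,0)\<close> is \<open>o(t)\<close> on the circle;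
  interpolating with the \<open>O(t)\<close> bound on the Dirichlet seminorm gives \<open>E = o(t)\<close> uniformly. Comparing
  arguments, \<open>\<i>(\<phi> - \<phi>') = cnj L - q = t (p - cnj p) + o(t)\<close>, where \<open>\<phi>'\<close> is the outer angle.
\<close>

section \<open>Holomorphic functions on the closed disc\<close>

lemma circle_mean_value:
  assumes "continuous_on (cball 0 1) E" "E holomorphic_on ball 0 1"
  shows "((\<lambda>x. E (cis x)) has_integral 2 * of_real pi * E 0) {0..2*pi}"
proof -
  have "((\<lambda>u. E u / (u - 0)) has_contour_integral (2 * of_real pi * \<i> * E 0)) (part_circlepath 0 1 0 (2*pi))"
    using Cauchy_integral_circlepath[OF assms, of 0] by (simp add: circlepath_def)
  then have "((\<lambda>t. E (cis t) / cis t * \<i> * cis t) has_integral (2 * of_real pi * \<i> * E 0)) {0..2*pi}"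
    by (subst (asm) has_contour_integral_part_circlepath_iff) auto
  \<comment> \<open>On the circle dz/z = i dx, so the factor -i turns the contour integral into an
    integral over the angle.\<close>
  then have "((\<lambda>t. (-\<i>) * (E (cis t) / cis t * \<i> * cis t)) has_integral (-\<i>) * (2 * of_real pi * \<i> * E 0)) {0..2*pi}"
    by (rule has_integral_mult_right)
  then show ?thesis
    by (simp add: field_simps)
qed

lemma continuous_on_circle:
  assumes "continuous_on (cball 0 1) E"
  shows "continuous_on S (\<lambda>x. E (cis x))"
  by (rule continuous_on_compose2[OF assms]) (auto intro!: continuous_intros)

lemma continuous_on_circle_rotate:
  assumes "continuous_on (cball 0 1) E"
  shows "continuous_on S (\<lambda>x. E (cis h * cis x))"
  by (rule continuous_on_compose2[OF assms]) (auto intro!: continuous_intros simp: norm_mult)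

text \<open>The square of \<open>E\<close> is holomorphic and vanishes at 0, so its mean over the
  circle is zero; the real part of that square is
  \<open>(Re E)\<^sup>2 - (Im E)\<^sup>2\<close>.\<close>

lemma circle_integral_Re_Im:
  assumes E: "continuous_on (cball 0 1) E" "E holomorphic_on ball 0 1" "E 0 = 0"
  shows "integral {0..2*pi} (\<lambda>x. (Re (E (cis x)))\<^sup>2) = integral {0..2*pi} (\<lambda>x. (Im (E (cis x)))\<^sup>2)"
    and "integral {0..2*pi} (\<lambda>x. (cmod (E (cis x)))\<^sup>2) = 2 * integral {0..2*pi} (\<lambda>x. (Re (E (cis x)))\<^sup>2)"
    and "integral {0..2*pi} (\<lambda>x. Im (E (cis x))) = 0"
proof -
  have c: "continuous_on {0..2*pi} (\<lambda>x. E (cis x))"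
    by (rule continuous_on_circle[OF E(1)])
  have "((\<lambda>x. (E (cis x))\<^sup>2) has_integral 2 * of_real pi * (E 0)\<^sup>2) {0..2*pi}"
    by (intro circle_mean_value[where E="\<lambda>z. (E z)\<^sup>2"] continuous_intros holomorphic_intros E)
  then have "((\<lambda>x. Re ((E (cis x))\<^sup>2)) has_integral 0) {0..2*pi}"
    by (drule_tac has_integral_Re) (simp add: E(3))
  moreover have "((\<lambda>x. (Re (E (cis x)))\<^sup>2 - (Im (E (cis x)))\<^sup>2) has_integral
      integral {0..2*pi} (\<lambda>x. (Re (E (cis x)))\<^sup>2) - integral {0..2*pi} (\<lambda>x. (Im (E (cis x)))\<^sup>2)) {0..2*pi}"
    by (intro has_integral_diff integrable_integral integrable_continuous_interval continuous_intros c)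
  ultimately show 1: "integral {0..2*pi} (\<lambda>x. (Re (E (cis x)))\<^sup>2) = integral {0..2*pi} (\<lambda>x. (Im (E (cis x)))\<^sup>2)"
    by (simp add: Re_power2) (drule (1) has_integral_unique, simp)
  have "integral {0..2*pi} (\<lambda>x. (cmod (E (cis x)))\<^sup>2) =
     integral {0..2*pi} (\<lambda>x. (Re (E (cis x)))\<^sup>2 + (Im (E (cis x)))\<^sup>2)"
    by (simp add: cmod_power2)
  also have "\<dots> = integral {0..2*pi} (\<lambda>x. (Re (E (cis x)))\<^sup>2) + integral {0..2*pi} (\<lambda>x. (Im (E (cis x)))\<^sup>2)"
    by (intro integral_add integrable_continuous_interval continuous_intros c)
  finally show "integral {0..2*pi} (\<lambda>x. (cmod (E (cis x)))\<^sup>2) = 2 * integral {0..2*pi} (\<lambda>x. (Re (E (cis x)))\<^sup>2)"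
    using 1 by simp
  have "((\<lambda>x. Im (E (cis x))) has_integral 0) {0..2*pi}"
    using has_integral_Im[OF circle_mean_value[OF E(1,2)]] E(3) by simp
  then show "integral {0..2*pi} (\<lambda>x. Im (E (cis x))) = 0"
    by (rule integral_unique)
qed

text \<open>For functions given by a formula singular at 0: holomorphy after removal of the
  singularity gives continuity inside, and the formula gives it away from 0.\<close>

lemma continuous_on_cball_if_ball:
  fixes E :: "complex \<Rightarrow> complex"
  assumes "continuous_on (cball 0 1 - {0}) E" "continuous_on (ball 0 1) E"
  shows "continuous_on (cball 0 1) E"
proof -
  have "continuous_on (ball 0 1 \<union> (cball 0 1 - {0})) E"
    by (rule continuous_on_Un_local_open[OF _ _ assms(2,1)])
       (auto simp: openin_open intro: exI[of _ "ball 0 1"] exI[of _ "-{0}"])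
  moreover have "ball 0 1 \<union> (cball 0 1 - {0}) = cball (0::complex) 1"
    by (auto simp: dist_norm)
  ultimately show ?thesis by simp
qed

text \<open>Split off the constant term, \<open>E = a\<^sub>0 + z E\<^sub>1\<close>; the two summands are orthogonal on the circle.\<close>
lemma Bessel_power_series:
  fixes a :: "nat \<Rightarrow> complex"
  assumes "continuous_on (cball 0 1) E" "\<And>z. z \<in> ball 0 1 \<Longrightarrow> (\<lambda>n. a n * z ^ n) sums E z"
  shows "2 * pi * (\<Sum>n<N. (cmod (a n))\<^sup>2) \<le> integral {0..2*pi} (\<lambda>x. (cmod (E (cis x)))\<^sup>2)"
  using assms
proof (induction N arbitrary: E a)
  case 0
  then show ?case by (auto intro!: integral_nonneg integrable_continuous_interval continuous_intros continuous_on_circle)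
next
  case (Suc N)
  have a0: "E 0 = a 0"
    using sums_unique2[OF Suc.prems(2)[of 0] powser_sums_zero] by simp
  define E1 where "E1 z = (if z = 0 then a 1 else (E z - a 0) / z)" for z
  have E_eq: "E z = a 0 + z * E1 z" for z
    by (auto simp: E1_def a0)
  have sums1: "(\<lambda>n. a (Suc n) * z ^ n) sums E1 z" if z: "z \<in> ball 0 1" for z
  proof (cases "z = 0")
    case True
    then show ?thesis using powser_sums_zero[of "\<lambda>n. a (Suc n)"] by (simp add: E1_def)
  next
    case False
    have "(\<lambda>n. a (Suc n) * z ^ Suc n) sums (E z - a 0)"
      using Suc.prems(2)[OF z] by (subst sums_Suc_iff) simp
    from sums_divide[OF this, of z] show ?thesis
      using False by (simp add: E1_def field_simps)
  qed
  have hol1: "E1 holomorphic_on ball 0 1"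
    using power_series_holomorphic[of 0 1 "\<lambda>n. a (Suc n)" E1] sums1 by simp
  have "continuous_on (cball 0 1 - {0}) (\<lambda>z. (E z - a 0) / z)"
    by (intro continuous_intros continuous_on_subset[OF Suc.prems(1)]) auto
  then have "continuous_on (cball 0 1 - {0}) E1"
    by (rule continuous_on_eq) (auto simp: E1_def)
  then have cont1: "continuous_on (cball 0 1) E1"
    by (rule continuous_on_cball_if_ball) (rule holomorphic_on_imp_continuous_on[OF hol1])
  have c: "continuous_on {0..2*pi} (\<lambda>x. E1 (cis x))"
    by (rule continuous_on_circle[OF cont1])
  \<comment> \<open>The cross term has mean zero: conjugating only the constant keeps the integrand
    holomorphic, and it vanishes at 0.\<close>
  have "((\<lambda>x. cnj (a 0) * (cis x * E1 (cis x))) has_integral 2 * of_real pi * (cnj (a 0) * (0 * E1 0))) {0..2*pi}"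
    by (intro circle_mean_value[where E="\<lambda>z. cnj (a 0) * (z * E1 z)"] continuous_intros holomorphic_intros cont1 hol1)
  from has_integral_Re[OF this]
  have z: "((\<lambda>x. Re (cnj (a 0) * (cis x * E1 (cis x)))) has_integral 0) {0..2*pi}"
    by simp
  have "((\<lambda>x. (cmod (a 0))\<^sup>2 + (cmod (E1 (cis x)))\<^sup>2 + 2 * Re (cnj (a 0) * (cis x * E1 (cis x))))
     has_integral (2 * pi - 0) *\<^sub>R (cmod (a 0))\<^sup>2 + integral {0..2*pi} (\<lambda>x. (cmod (E1 (cis x)))\<^sup>2) + 2 * 0) {0..2*pi}"
    by (intro has_integral_add has_integral_mult_right z integrable_integral integrable_continuous_interval
        continuous_intros c) (use has_integral_const_real[of "(cmod (a 0))\<^sup>2" 0 "2*pi"] in simp)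
  moreover have "(cmod (a 0))\<^sup>2 + (cmod (E1 (cis x)))\<^sup>2 + 2 * Re (cnj (a 0) * (cis x * E1 (cis x))) = (cmod (E (cis x)))\<^sup>2" for x
  proof -
    have *: "(cmod (u + v))\<^sup>2 = (cmod u)\<^sup>2 + (cmod v)\<^sup>2 + 2 * Re (cnj u * v)" for u v
      unfolding cmod_power2 by (simp add: power2_eq_square algebra_simps)
    show ?thesis
      unfolding E_eq[of "cis x"] * by (simp add: norm_mult)
  qed
  ultimately have "((\<lambda>x. (cmod (E (cis x)))\<^sup>2) has_integral
      2 * pi * (cmod (a 0))\<^sup>2 + integral {0..2*pi} (\<lambda>x. (cmod (E1 (cis x)))\<^sup>2)) {0..2*pi}"
    by simp
  then have "integral {0..2*pi} (\<lambda>x. (cmod (E (cis x)))\<^sup>2) =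
      2 * pi * (cmod (a 0))\<^sup>2 + integral {0..2*pi} (\<lambda>x. (cmod (E1 (cis x)))\<^sup>2)"
    by (rule integral_unique)
  moreover have "2 * pi * (\<Sum>n<N. (cmod (a (Suc n)))\<^sup>2) \<le> integral {0..2*pi} (\<lambda>x. (cmod (E1 (cis x)))\<^sup>2)"
    by (rule Suc.IH[OF cont1 sums1])
  ultimately show ?case
    by (simp add: sum.lessThan_Suc_shift algebra_simps del: sum.lessThan_Suc)
qed

section \<open>The Dirichlet seminorm through small rotations, and a sup bound from it\<close>

lemma cis_difference_quotient: "((\<lambda>h. cmod (cis (real n * h) - 1) / h) \<longlongrightarrow> real n) (at_right 0)"
proof -
  have "((\<lambda>h::complex. exp (\<i> * of_nat n * h)) has_field_derivative \<i> * of_nat n) (at 0)"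
    by (auto intro!: derivative_eq_intros)
  then have "((\<lambda>h::complex. (exp (\<i> * of_nat n * h) - 1) / h) \<longlongrightarrow> \<i> * of_nat n) (at 0)"
    by (simp add: has_field_derivative_iff)
  moreover have "filterlim (\<lambda>h. of_real h :: complex) (at 0) (at_right 0)"
    by (auto simp: filterlim_at eventually_at_filter intro!: tendsto_eq_intros)
  ultimately have "((\<lambda>h. (exp (\<i> * of_nat n * of_real h) - 1) / of_real h) \<longlongrightarrow> \<i> * of_nat n) (at_right 0)"
    by (rule filterlim_compose)
  from tendsto_norm[OF this] have "((\<lambda>h. cmod (cis (real n * h) - 1) / \<bar>h\<bar>) \<longlongrightarrow> real n) (at_right 0)"
    by (simp add: cis_conv_exp norm_divide norm_mult mult.assoc)
  moreover have "\<forall>\<^sub>F h in at_right 0. cmod (cis (real n * h) - 1) / \<bar>h\<bar> = cmod (cis (real n * h) - 1) / h"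
    by (auto simp: eventually_at_filter)
  ultimately show ?thesis
    by (rule Lim_transform_eventually)
qed

lemma sum_inverse_squares_tail:
  fixes N m :: nat
  assumes "N \<ge> 1"
  shows "(\<Sum>n=Suc N..<m. 1 / (real n)\<^sup>2) \<le> 1 / N"
proof (cases "m \<le> Suc N")
  case True
  then show ?thesis by simp
next
  case False
  then have "m \<ge> Suc N" by simp
  \<comment> \<open>Each term is at most \<open>1 / (k - 1) - 1 / k\<close>, which telescopes. The
    subtracted \<open>1 / (m - 1)\<close> is what makes the induction close.\<close>
  then have "(\<Sum>n=Suc N..<m. 1 / (real n)\<^sup>2) \<le> 1 / N - 1 / (real m - 1)"
  proof (induction m rule: dec_induct)
    case base
    then show ?case by simp
  next
    case (step k)
    have "1 / (real k)\<^sup>2 \<le> 1 / (real k - 1) - 1 / real k"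
      using step.hyps assms by (auto simp: field_simps power2_eq_square)
    then show ?case using step by simp
  qed
  also have "\<dots> \<le> 1 / N" using False assms by simp
  finally show ?thesis .
qed

text \<open>Rotation by \<open>h\<close> followed by subtraction multiplies the n-th coefficient by
  \<open>cis (n * h) - 1\<close>. Bessel's inequality for this difference, divided by
  \<open>h\<^sup>2\<close>, passes to the limit h -> 0+ because the sum is finite.\<close>

lemma Dirichlet_seminorm_le:
  fixes a :: "nat \<Rightarrow> complex"
  assumes E: "continuous_on (cball 0 1) E" "\<And>z. z \<in> ball 0 1 \<Longrightarrow> (\<lambda>n. a n * z ^ n) sums E z"
    and bound: "\<forall>\<^sub>F h in at_right 0.
      integral {0..2*pi} (\<lambda>x. (cmod (E (cis h * cis x) - E (cis x)))\<^sup>2) \<le> 2 * pi * K\<^sup>2 * h\<^sup>2"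
  shows "(\<Sum>n<N. (real n * cmod (a n))\<^sup>2) \<le> K\<^sup>2"
proof (rule tendsto_upperbound)
  show "((\<lambda>h. \<Sum>n<N. (cmod (cis (real n * h) - 1) / h * cmod (a n))\<^sup>2) \<longlongrightarrow> (\<Sum>n<N. (real n * cmod (a n))\<^sup>2)) (at_right 0)"
    by (intro tendsto_intros cis_difference_quotient)
  show "\<forall>\<^sub>F h in at_right 0. (\<Sum>n<N. (cmod (cis (real n * h) - 1) / h * cmod (a n))\<^sup>2) \<le> K\<^sup>2"
    using bound eventually_at_right_less[of 0]
  proof eventually_elim
    case (elim h)
    have "2 * pi * (\<Sum>n<N. (cmod (a n * (cis (real n * h) - 1)))\<^sup>2)
        \<le> integral {0..2*pi} (\<lambda>x. (cmod (E (cis h * cis x) - E (cis x)))\<^sup>2)"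
    proof (rule Bessel_power_series[where E = "\<lambda>z. E (cis h * z) - E z"])
      show "continuous_on (cball 0 1) (\<lambda>z. E (cis h * z) - E z)"
        by (intro continuous_intros E(1) continuous_on_compose2[OF E(1)]) (auto simp: norm_mult)
      show "(\<lambda>n. a n * (cis (real n * h) - 1) * z ^ n) sums (E (cis h * z) - E z)" if "z \<in> ball 0 1" for z
        using sums_diff[OF E(2)[of "cis h * z"] E(2)[of z]] that
        by (simp add: norm_mult power_mult_distrib algebra_simps flip: Complex.DeMoivre) (simp add: mult.commute[of h] flip: Complex.DeMoivre)
    qed
    also note elim(1)
    finally have "(\<Sum>n<N. (cmod (a n * (cis (real n * h) - 1)))\<^sup>2) \<le> K\<^sup>2 * h\<^sup>2"
      by simp
    then have "(\<Sum>n<N. (cmod (a n * (cis (real n * h) - 1)))\<^sup>2) / h\<^sup>2 \<le> K\<^sup>2"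
      using elim(2) by (simp add: field_simps)
    then show ?case
      by (simp add: sum_divide_distrib norm_mult power_divide power_mult_distrib mult.commute)
  qed
qed simp

text \<open>Low coefficients are controlled by the real part on the circle, high ones by the Dirichlet seminorm.\<close>
lemma sup_bound_from_real_part:
  fixes a :: "nat \<Rightarrow> complex" and N :: nat
  assumes E: "continuous_on (cball 0 1) E" "\<And>z. z \<in> ball 0 1 \<Longrightarrow> (\<lambda>n. a n * z ^ n) sums E z"
    and real0: "Im (E 0) = 0"
    and Re_bound: "\<And>z. cmod z = 1 \<Longrightarrow> \<bar>Re (E z)\<bar> \<le> \<delta>"
    and K: "K \<ge> 0" "\<And>N. (\<Sum>n<N. (real n * cmod (a n))\<^sup>2) \<le> K\<^sup>2"
    and N: "N \<ge> 1" and z: "z \<in> cball 0 1"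
  shows "cmod (E z) \<le> \<delta> + 3 * sqrt N * \<delta> + K / sqrt N"
proof -
  have hol: "E holomorphic_on ball 0 1"
    using power_series_holomorphic[of 0 1 a E] E(2) by simp
  have a0: "E 0 = a 0"
    using sums_unique2[OF E(2)[of 0] powser_sums_zero] by simp
  have d0: "\<delta> \<ge> 0" using Re_bound[of 1] by simp
  have "((\<lambda>x. Re (E (cis x))) has_integral 2 * pi * Re (a 0)) {0..2*pi}"
    using has_integral_Re[OF circle_mean_value[OF E(1) hol]] a0 by simp
  then have "norm (2 * pi * Re (a 0)) \<le> \<delta> * measure lborel (cbox 0 (2*pi))"
    using d0 Re_bound by (intro has_integral_bound[where f = "\<lambda>x. Re (E (cis x))"]) auto
  then have "\<bar>Re (a 0)\<bar> \<le> \<delta>"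
    by (simp add: abs_mult)
  moreover have "Im (a 0) = 0" using a0 real0 by simp
  ultimately have a0_le: "cmod (a 0) \<le> \<delta>" "\<bar>Re (a 0)\<bar> \<le> \<delta>"
    by (auto simp: cmod_eq_Re)
  \<comment> \<open>The constant term is split off because the identity between real part and
    modulus in mean square requires a function vanishing at 0.\<close>
  define b where "b n = (if n = 0 then 0 else a n)" for n
  \<comment> \<open>The real part of \<open>E - a 0\<close> is at most 2 \<delta> in modulus, and
    the full mean square is twice that of the real part: this gives 8 \<delta> squared, rounded up
    to 9 to have a clean root.\<close>
  have low: "(\<Sum>n<m. (cmod (b n))\<^sup>2) \<le> (3 * \<delta>)\<^sup>2" for m
  proof -
    have c: "continuous_on (cball 0 1) (\<lambda>z. E z - a 0)"
      by (intro continuous_intros E)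
    have "2 * pi * (\<Sum>n<m. (cmod (b n))\<^sup>2) \<le> integral {0..2*pi} (\<lambda>x. (cmod (E (cis x) - a 0))\<^sup>2)"
    proof (rule Bessel_power_series[OF c])
      show "(\<lambda>n. b n * z ^ n) sums (E z - a 0)" if "z \<in> ball 0 1" for z
      proof -
        have "(\<lambda>n. a n * z ^ n - (if n = 0 then a 0 else 0)) sums (E z - a 0)"
          by (rule sums_diff[OF E(2)[OF that]]) (use sums_single[of 0 "\<lambda>_. a 0"] in simp)
        then show ?thesis
          by (rule sums_cong[THEN iffD1, rotated]) (auto simp: b_def)
      qed
    qed
    also have "\<dots> = 2 * integral {0..2*pi} (\<lambda>x. (Re (E (cis x) - a 0))\<^sup>2)"
      by (rule circle_integral_Re_Im(2)[OF c]) (auto intro!: holomorphic_intros hol simp: a0)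
    also have "\<dots> \<le> 2 * integral {0..2*pi} (\<lambda>x. (2 * \<delta>)\<^sup>2)"
    proof (intro mult_left_mono integral_le)
      show "(\<lambda>x. (Re (E (cis x) - a 0))\<^sup>2) integrable_on {0..2*pi}"
        by (intro integrable_continuous_interval continuous_intros continuous_on_circle E)
      show "(Re (E (cis x) - a 0))\<^sup>2 \<le> (2 * \<delta>)\<^sup>2" for x
        by (rule abs_le_square_iff[THEN iffD1]) (use Re_bound[of "cis x"] a0_le(2) in auto)
    qed auto
    also have "\<dots> = 2 * pi * (8 * \<delta>\<^sup>2)" by (simp add: power2_eq_square)
    finally have "(\<Sum>n<m. (cmod (b n))\<^sup>2) \<le> 8 * \<delta>\<^sup>2" by simp
    then show ?thesis by (simp add: power_mult_distrib) (smt (verit) zero_le_power2)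
  qed
  have CS: "(\<Sum>n\<in>A. u n * v n) \<le> sqrt (\<Sum>n\<in>A. (u n)\<^sup>2) * sqrt (\<Sum>n\<in>A. (v n)\<^sup>2)"
    if "\<And>n. n \<in> A \<Longrightarrow> u n \<ge> 0" "\<And>n. n \<in> A \<Longrightarrow> v n \<ge> 0" for A :: "nat set" and u v :: "nat \<Rightarrow> real"
    using L2_set_mult_ineq[of u v A] that by (simp add: L2_set_def)
  have sumb: "(\<Sum>n<m. cmod (b n)) \<le> 3 * sqrt N * \<delta> + K / sqrt N" for m
  proof -
    \<comment> \<open>Frequencies are split at \<open>N\<close>. The low block is always taken in
      full, even when \<open>m\<close> is smaller, hence an inequality.\<close>
    have "(\<Sum>n<m. cmod (b n)) \<le> (\<Sum>n\<in>{1..N} \<union> {Suc N..<m}. cmod (b n))"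
    proof -
      have "(\<Sum>n<m. cmod (b n)) = (\<Sum>n\<in>{1..<m}. cmod (b n))"
        by (rule sum.mono_neutral_right) (auto simp: b_def)
      also have "\<dots> \<le> (\<Sum>n\<in>{1..N} \<union> {Suc N..<m}. cmod (b n))"
        by (rule sum_mono2) auto
      finally show ?thesis .
    qed
    also have "\<dots> = (\<Sum>n=1..N. cmod (b n)) + (\<Sum>n=Suc N..<m. cmod (b n))"
      by (rule sum.union_disjoint) auto
    also have "(\<Sum>n=1..N. cmod (b n)) \<le> 3 * sqrt N * \<delta>"
    proof -
      have "(\<Sum>n=1..N. 1 * cmod (b n)) \<le> sqrt (\<Sum>n=1..N. 1\<^sup>2) * sqrt (\<Sum>n=1..N. (cmod (b n))\<^sup>2)"
        by (rule CS) auto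
      also have "\<dots> \<le> sqrt N * sqrt ((3 * \<delta>)\<^sup>2)"
      proof (intro mult_mono real_sqrt_le_mono)
        have "(\<Sum>n=1..N. (cmod (b n))\<^sup>2) \<le> (\<Sum>n<Suc N. (cmod (b n))\<^sup>2)"
          by (rule sum_mono2) auto
        also have "\<dots> \<le> (3 * \<delta>)\<^sup>2" by (rule low)
        finally show "(\<Sum>n=1..N. (cmod (b n))\<^sup>2) \<le> (3 * \<delta>)\<^sup>2" .
      qed (auto intro!: sum_nonneg)
      also have "sqrt ((3 * \<delta>)\<^sup>2) = 3 * \<delta>" using d0 by (intro real_sqrt_unique) auto
      finally show ?thesis by (simp add: mult_ac)
    qed
    also have "(\<Sum>n=Suc N..<m. cmod (b n)) \<le> K / sqrt N"
    proof -
      \<comment> \<open>Cauchy-Schwarz with weights 1/n and n: the first factor is the tail of the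
        sum of inverse squares, the second is the Dirichlet seminorm.\<close>
      have "(\<Sum>n=Suc N..<m. cmod (b n)) = (\<Sum>n=Suc N..<m. (1 / real n) * (real n * cmod (a n)))"
        by (rule sum.cong) (auto simp: b_def)
      also have "\<dots> \<le> sqrt (\<Sum>n=Suc N..<m. (1 / real n)\<^sup>2) * sqrt (\<Sum>n=Suc N..<m. (real n * cmod (a n))\<^sup>2)"
        by (rule CS) auto
      also have "\<dots> \<le> sqrt (1 / N) * sqrt (K\<^sup>2)"
      proof (intro mult_mono real_sqrt_le_mono)
        show "(\<Sum>n=Suc N..<m. (1 / real n)\<^sup>2) \<le> 1 / N"
          using sum_inverse_squares_tail[OF N] by (simp add: power_divide)
        have "(\<Sum>n=Suc N..<m. (real n * cmod (a n))\<^sup>2) \<le> (\<Sum>n<m. (real n * cmod (a n))\<^sup>2)"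
          by (rule sum_mono2) auto
        also have "\<dots> \<le> K\<^sup>2" by (rule K)
        finally show "(\<Sum>n=Suc N..<m. (real n * cmod (a n))\<^sup>2) \<le> K\<^sup>2" .
      qed (auto intro!: sum_nonneg)
      also have "\<dots> = K / sqrt N" using K by (simp add: real_sqrt_divide)
      finally show ?thesis .
    qed
    finally show ?thesis by simp
  qed
  have interior: "cmod (E z) \<le> \<delta> + 3 * sqrt N * \<delta> + K / sqrt N" if z: "z \<in> ball 0 1" for z
  proof (rule Lim_bounded)
    show "(\<lambda>m. cmod (\<Sum>n<m. a n * z ^ n)) \<longlonglongrightarrow> cmod (E z)"
      using E(2)[OF z] by (intro tendsto_norm) (simp add: sums_def)
    show "\<forall>m\<ge>0. cmod (\<Sum>n<m. a n * z ^ n) \<le> \<delta> + 3 * sqrt N * \<delta> + K / sqrt N"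
    proof (intro allI impI)
      fix m
      have "cmod (\<Sum>n<m. a n * z ^ n) \<le> (\<Sum>n<m. cmod (a n))"
      proof (rule sum_norm_le)
        have "cmod z ^ n \<le> 1" for n using z by (intro power_le_one) auto
        then show "cmod (a n * z ^ n) \<le> cmod (a n)" for n
          by (simp add: norm_mult norm_power mult_left_le)
      qed
      also have "\<dots> = (\<Sum>n<m. (if n = 0 then cmod (a 0) else 0) + cmod (b n))"
        by (rule sum.cong) (auto simp: b_def)
      also have "\<dots> = (\<Sum>n<m. if n = 0 then cmod (a 0) else 0) + (\<Sum>n<m. cmod (b n))"
        by (rule sum.distrib)
      also have "(\<Sum>n<m. if n = 0 then cmod (a 0) else 0) \<le> \<delta>"
        using a0_le d0 by (cases m) (auto simp: sum.delta)
      also note sumb[of m]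
      finally show "cmod (\<Sum>n<m. a n * z ^ n) \<le> \<delta> + 3 * sqrt N * \<delta> + K / sqrt N" by simp
    qed
  qed
  have "closure (ball 0 1) = cball (0::complex) 1" by simp
  then show ?thesis
    using continuous_on_closure_norm_le[of "ball 0 1" E "\<delta> + 3 * sqrt N * \<delta> + K / sqrt N" z] E(1) interior z
    by auto
qed

section \<open>The welding relation\<close>

lemma norm_cis_diff_le: "cmod (cis x - cis y) \<le> \<bar>x - y\<bar>"
proof -
  have "cis x - cis y = cis y * (exp (\<i> * of_real (x - y)) - 1)"
    by (simp add: algebra_simps cis_mult flip: cis_conv_exp del: of_real_diff)
  then have "cmod (cis x - cis y) = 2 * \<bar>sin ((x - y) / 2)\<bar>"
    by (simp add: norm_mult dist_exp_i_1 del: of_real_diff)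
  then show ?thesis using abs_sin_x_le_abs_x[of "(x - y) / 2"] by simp
qed

text \<open>Dividing the two welding equations and taking logarithms gives
  \<open>\<i> * \<phi> + d = \<i> * h + cnj (l2 - l1)\<close> modulo 2 pi i, where \<phi> is the
  angle from \<open>w1\<close> to \<open>w2\<close> and \<open>d\<close> is the increment of
  \<open>q\<close>. Real parts give \<open>Re d = Re (l2 - l1)\<close>, bounded by \<epsilon> times
  |\<phi>|, and imaginary parts bound |\<phi>|.\<close>

lemma welding_difference_bound:
  assumes w: "cmod w1 = 1" "cmod w2 = 1"
    and eq1: "w1 * exp (q w1) = cis x * exp (cnj l1)"
    and eq2: "w2 * exp (q w2) = cis (x + h) * exp (cnj l2)"
    and lip: "cmod (q w2 - q w1) \<le> \<epsilon> * cmod (w2 - w1)" and eps: "\<epsilon> \<le> 1/2" "\<epsilon> \<ge> 0"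
    and small: "\<bar>h - Im (l2 - l1)\<bar> \<le> 1"
  shows "\<bar>Re (l2 - l1)\<bar> \<le> 2 * \<epsilon> * \<bar>h - Im (l2 - l1)\<bar>"
proof -
  define \<phi> where "\<phi> = Arg (w2 / w1)"
  have nz: "w1 \<noteq> 0" "w2 \<noteq> 0" using w by auto
  have \<phi>: "w2 = w1 * cis \<phi>" "\<bar>\<phi>\<bar> \<le> pi"
    using cis_Arg[of "w2/w1"] nz w Arg_bounded[of "w2/w1"]
    by (auto simp: \<phi>_def sgn_eq norm_divide)
  have "w1 * exp (q w1) * exp (\<i> * \<phi> + (q w2 - q w1)) = w2 * exp (q w2)"
    by (simp add: \<phi>(1) cis_conv_exp flip: exp_add)
  also have "\<dots> = (cis x * exp (cnj l1)) * exp (\<i> * h + cnj (l2 - l1))"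
    by (simp add: eq2 cis_conv_exp flip: exp_add) (simp add: algebra_simps)
  finally have "exp (\<i> * \<phi> + (q w2 - q w1)) = exp (\<i> * h + cnj (l2 - l1))"
    using eq1 by simp
  then obtain n :: int where n: "\<i> * \<phi> + (q w2 - q w1) = \<i> * h + cnj (l2 - l1) + (of_int (2 * n) * pi) * \<i>"
    unfolding exp_eq by blast
  define d where "d = q w2 - q w1"
  have re: "Re d = Re (l2 - l1)" and im: "\<phi> + Im d = h - Im (l2 - l1) + 2 * pi * n"
    using arg_cong[OF n, of Re] arg_cong[OF n, of Im] by (simp_all add: d_def algebra_simps)
  have "cmod (w2 - w1) \<le> \<bar>\<phi>\<bar>"
  proof -
    have "w2 - w1 = w1 * (cis \<phi> - cis 0)" by (simp add: \<phi>(1) algebra_simps)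
    then have "cmod (w2 - w1) = cmod (cis \<phi> - cis 0)" using w by (simp only: norm_mult mult_1)
    then show ?thesis using norm_cis_diff_le[of \<phi> 0] by simp
  qed
  then have dle: "cmod d \<le> \<epsilon> * \<bar>\<phi>\<bar>"
    using lip eps mult_left_mono[of _ _ \<epsilon>] unfolding d_def by (meson order_trans)
  have "cmod d \<le> 1/2 * pi"
    using dle mult_mono[OF eps(1) \<phi>(2)] by linarith
  \<comment> \<open>The three contributions, at most pi, pi/2 and 1, add up to less than 2 pi, so
    the branch integer is 0.\<close>
  then have "\<bar>2 * pi * n\<bar> \<le> pi + 1/2 * pi + 1"
    using im small \<phi>(2) abs_Im_le_cmod[of d] by linarith
  then have "\<bar>2 * pi * n\<bar> < 2 * pi * 1" using pi_gt3 by linarith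
  then have "\<bar>real_of_int n\<bar> < 1" by (simp add: abs_mult)
  then have "n = 0" by linarith
  then have "\<bar>\<phi>\<bar> \<le> \<bar>h - Im (l2 - l1)\<bar> + \<epsilon> * \<bar>\<phi>\<bar>"
    using im dle abs_Im_le_cmod[of d] by simp
  \<comment> \<open>Since \<epsilon> is at most 1/2, the term from \<open>d\<close> is absorbed into
    the left side, at the cost of a factor 2.\<close>
  moreover have "\<epsilon> * \<bar>\<phi>\<bar> \<le> 1/2 * \<bar>\<phi>\<bar>"
    using eps by (intro mult_right_mono) auto
  moreover have "A \<le> 2 * X" if "A \<le> X + Y" "Y \<le> 1/2 * A" for A X Y :: real
    using that by linarith
  ultimately have "\<bar>\<phi>\<bar> \<le> 2 * \<bar>h - Im (l2 - l1)\<bar>" by blast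
  then have "\<epsilon> * \<bar>\<phi>\<bar> \<le> \<epsilon> * (2 * \<bar>h - Im (l2 - l1)\<bar>)"
    using eps by (intro mult_left_mono) auto
  then show ?thesis using dle re abs_Re_le_cmod[of d] by simp
qed

text \<open>The pointwise bound is squared and integrated. The mixed term \<open>h * Im D\<close>
  has mean zero, and the mean squares of \<open>Re D\<close> and \<open>Im D\<close> agree, so the
  unknown integral reappears on the right with a coefficient small enough to be absorbed.\<close>

lemma welding_square_bound:
  assumes L: "continuous_on (cball 0 1) L" "L holomorphic_on ball 0 1"
    and weld: "\<And>z. cmod z = 1 \<Longrightarrow> \<exists>w. cmod w = 1 \<and> w * exp (q w) = z * exp (cnj (L z))"
    and lip: "\<And>w w'. cmod w = 1 \<Longrightarrow> cmod w' = 1 \<Longrightarrow> cmod (q w' - q w) \<le> \<epsilon> * cmod (w' - w)"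
    and eps: "\<epsilon> \<le> 1/4" "\<epsilon> \<ge> 0"
  shows "\<forall>\<^sub>F h in at_right 0.
      integral {0..2*pi} (\<lambda>x. (cmod (L (cis h * cis x) - L (cis x)))\<^sup>2) \<le> 2 * pi * (4 * \<epsilon>)\<^sup>2 * h\<^sup>2"
proof -
  \<comment> \<open>Only a qualitative modulus of continuity is used: it makes
    \<open>h - Im D\<close> at most 1 for small \<open>h\<close>, which fixes the branch of the
    logarithm. It does not enter the final constant.\<close>
  have "uniformly_continuous_on (cball 0 1) L"
    by (rule compact_uniformly_continuous[OF L(1)]) auto
  then obtain d where d: "d > 0" "\<And>x y. x \<in> cball 0 1 \<Longrightarrow> y \<in> cball 0 1 \<Longrightarrow> dist x y < d \<Longrightarrow> dist (L x) (L y) < 1/2"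
    unfolding uniformly_continuous_on_def by (metis zero_less_divide_1_iff zero_less_numeral)
  have "\<forall>\<^sub>F h in at_right 0. 0 < h \<and> h < min d (1/2 :: real)"
    using d(1) by (auto simp: eventually_at_right_field intro: exI[of _ "min d (1/2)"])
  then show ?thesis
  proof eventually_elim
    case (elim h)
    define D where "D z = L (cis h * z) - L z" for z
    have D: "continuous_on (cball 0 1) D"
      unfolding D_def by (intro continuous_intros L(1) continuous_on_compose2[OF L(1)]) (auto simp: norm_mult)
    have "(\<lambda>z. L (cis h * z)) holomorphic_on ball 0 1"
      using holomorphic_on_compose_gen[of "\<lambda>z. cis h * z" "ball 0 1" L "ball 0 1"] L(2)
      by (fastforce simp: o_def norm_mult intro!: holomorphic_intros)
    then have hD: "D holomorphic_on ball 0 1"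
      unfolding D_def by (intro holomorphic_intros L)
    have D0: "D 0 = 0" by (simp add: D_def)
    have cD: "continuous_on {0..2*pi} (\<lambda>x. D (cis x))"
      by (rule continuous_on_circle[OF D])
    have pt: "(Re (D (cis x)))\<^sup>2 \<le> (2 * \<epsilon>)\<^sup>2 * (h - Im (D (cis x)))\<^sup>2" for x
    proof -
      obtain w1 where w1: "cmod w1 = 1" "w1 * exp (q w1) = cis x * exp (cnj (L (cis x)))"
        using weld[of "cis x"] by auto
      obtain w2 where w2: "cmod w2 = 1" "w2 * exp (q w2) = cis (x + h) * exp (cnj (L (cis (x + h))))"
        using weld[of "cis (x + h)"] by auto
      have "dist (cis (x + h)) (cis x) < d"
        using norm_cis_diff_le[of "x + h" x] elim by (simp add: dist_norm)
      then have "dist (L (cis (x + h))) (L (cis x)) < 1/2"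
        by (intro d) auto
      then have s: "\<bar>h - Im (L (cis (x + h)) - L (cis x))\<bar> \<le> 1"
        using abs_Im_le_cmod[of "L (cis (x + h)) - L (cis x)"] elim unfolding dist_norm by linarith
      have "\<bar>Re (L (cis (x + h)) - L (cis x))\<bar> \<le> 2 * \<epsilon> * \<bar>h - Im (L (cis (x + h)) - L (cis x))\<bar>"
        by (rule welding_difference_bound[OF w1(1) w2(1) w1(2) w2(2) lip[OF w1(1) w2(1)]]) (use eps s in auto)
      moreover have "L (cis (x + h)) - L (cis x) = D (cis x)"
        by (simp add: D_def cis_mult add.commute)
      ultimately have "\<bar>Re (D (cis x))\<bar> \<le> \<bar>2 * \<epsilon> * (h - Im (D (cis x)))\<bar>"
        using eps by (simp add: abs_mult)
      then show ?thesis by (simp only: abs_le_square_iff power_mult_distrib)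
    qed
    define X where "X = integral {0..2*pi} (\<lambda>x. (Re (D (cis x)))\<^sup>2)"
    have X0: "X \<ge> 0" unfolding X_def
      by (intro integral_nonneg integrable_continuous_interval continuous_intros cD) auto
    have XI: "integral {0..2*pi} (\<lambda>x. (Im (D (cis x)))\<^sup>2) = X"
      using circle_integral_Re_Im(1)[OF D hD D0] by (simp add: X_def)
    have "((\<lambda>x. h\<^sup>2 - 2 * h * Im (D (cis x)) + (Im (D (cis x)))\<^sup>2) has_integral
        (2 * pi - 0) *\<^sub>R h\<^sup>2 - 2 * h * integral {0..2*pi} (\<lambda>x. Im (D (cis x))) + integral {0..2*pi} (\<lambda>x. (Im (D (cis x)))\<^sup>2)) {0..2*pi}"
      by (intro has_integral_add has_integral_diff has_integral_mult_right integrable_integral integrable_continuous_interval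
        continuous_intros cD) (use has_integral_const_real[of "h\<^sup>2" 0 "2*pi"] in simp)
    then have "((\<lambda>x. (h - Im (D (cis x)))\<^sup>2) has_integral 2 * pi * h\<^sup>2 + X) {0..2*pi}"
      unfolding XI circle_integral_Re_Im(3)[OF D hD D0] by (simp add: power2_diff algebra_simps)
    then have "((\<lambda>x. (2 * \<epsilon>)\<^sup>2 * (h - Im (D (cis x)))\<^sup>2) has_integral (2 * \<epsilon>)\<^sup>2 * (2 * pi * h\<^sup>2 + X)) {0..2*pi}"
      by (rule has_integral_mult_right)
    then have "X \<le> (2 * \<epsilon>)\<^sup>2 * (2 * pi * h\<^sup>2 + X)"
      by (rule has_integral_le[OF _ _ pt, rotated])
        (auto simp: X_def intro!: integrable_integral integrable_continuous_interval continuous_intros cD)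
    \<comment> \<open>This is where \<epsilon> at most 1/4 enters: a quarter of \<open>X\<close> is
      absorbed on the left.\<close>
    moreover have "(2 * \<epsilon>)\<^sup>2 * X \<le> 1/4 * X"
    proof (rule mult_right_mono[OF _ X0])
      have "(2 * \<epsilon>)\<^sup>2 \<le> (1/2)\<^sup>2" using eps by (intro power_mono) auto
      then show "(2 * \<epsilon>)\<^sup>2 \<le> 1/4" by (simp add: power2_eq_square)
    qed
    ultimately have "X \<le> 2 * ((2 * \<epsilon>)\<^sup>2 * (2 * pi * h\<^sup>2))"
      using X0 by (simp add: distrib_left)
    then have "2 * X \<le> 2 * pi * (4 * \<epsilon>)\<^sup>2 * h\<^sup>2"
      by (simp add: power_mult_distrib mult_ac)
    moreover have "integral {0..2*pi} (\<lambda>x. (cmod (D (cis x)))\<^sup>2) = 2 * X"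
      unfolding X_def by (rule circle_integral_Re_Im(2)[OF D hD D0])
    ultimately show ?case by (simp add: D_def)
  qed
qed

section \<open>The exterior conformal map\<close>

text \<open>The image of the open disc is open and that of the closed disc is compact, so frontier
  points can only be values on the circle.\<close>

lemma frontier_image_ball_subset:
  fixes f :: "complex \<Rightarrow> complex"
  assumes "continuous_on (cball 0 1) f" "f holomorphic_on ball 0 1" "inj_on f (ball 0 1)"
  shows "frontier (f ` ball 0 1) \<subseteq> f ` sphere 0 1"
proof -
  have op: "open (f ` ball 0 1)"
    by (rule open_mapping_thm3[OF assms(2) open_ball assms(3)])
  have "closed (f ` cball 0 1)"
    by (intro compact_imp_closed compact_continuous_image assms) auto
  then have "closure (f ` ball 0 1) \<subseteq> f ` cball 0 1"
    by (intro closure_minimal image_mono) auto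
  then have "frontier (f ` ball 0 1) \<subseteq> f ` cball 0 1 - f ` ball 0 1"
    using op by (auto simp: frontier_def interior_open)
  also have "\<dots> \<subseteq> f ` sphere 0 1" by force
  finally show ?thesis .
qed

text \<open>By continuity \<open>F z\<close> lies in the closure of the outside. Were it in the
  outside itself, it would equal \<open>F y\<close> for some exterior \<open>y\<close>; by the open
  mapping theorem, values of \<open>F\<close> at exterior points near \<open>z\<close> would also be
  taken near \<open>y\<close>, against injectivity.\<close>

lemma exterior_map_boundary:
  fixes F :: "complex \<Rightarrow> complex"
  assumes hol: "F holomorphic_on {z. 1 < norm z}" and inj: "inj_on F {z. 1 < norm z}"
    and img: "F ` {z. 1 < norm z} = outside \<Gamma>" and cont: "continuous_on {z. 1 \<le> norm z} F"
    and \<Gamma>: "closed \<Gamma>" and z: "cmod z = 1"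
  shows "F z \<in> \<Gamma>"
proof (rule ccontr)
  have op: "open {z::complex. 1 < norm z}" by (intro open_Collect_less continuous_intros)
  have near: "\<exists>y. cmod y > 1 \<and> dist y z < e" if "e > 0" for e
  proof (intro exI conjI)
    have "cmod (of_real (1 + e/2) * z) = 1 + e/2"
      using that z by (simp only: norm_mult norm_of_real) simp
    then show "cmod (of_real (1 + e/2) * z) > 1" using that by simp
    have "of_real (1 + e/2) * z - z = of_real (e/2) * z" by (simp add: algebra_simps)
    then show "dist (of_real (1 + e/2) * z) z < e"
      using that z by (simp only: dist_norm norm_mult norm_of_real)
  qed
  have cl: "F z \<in> closure (outside \<Gamma>)"
  proof (rule closure_approachable[THEN iffD2], intro allI impI)
    fix e :: real assume "e > 0"
    then obtain d where d: "d > 0" "\<And>y. 1 \<le> cmod y \<Longrightarrow> dist y z < d \<Longrightarrow> dist (F y) (F z) < e"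
      using cont z unfolding continuous_on_iff by force
    obtain y where "cmod y > 1" "dist y z < d" using near[OF d(1)] by blast
    then show "\<exists>y\<in>outside \<Gamma>. dist y (F z) < e"
      using d(2)[of y] img by (intro bexI[of _ "F y"]) auto
  qed
  assume "F z \<notin> \<Gamma>"
  with cl closure_outside_subset[OF \<Gamma>] have "F z \<in> outside \<Gamma>" by blast
  then obtain y where y: "1 < cmod y" "F y = F z" using img by (metis (mono_tags, lifting) imageE mem_Collect_eq)
  \<comment> \<open>With half the distance from \<open>y\<close> to the circle as radius, a point
    within \<open>r\<close> of both \<open>y\<close> and \<open>z\<close> would force
    \<open>dist y z < 2 * r\<close>, which is impossible.\<close>
  define r where "r = (cmod y - 1) / 2"
  have r: "r > 0" using y by (simp add: r_def)
  have sub: "ball y r \<subseteq> {z. 1 < norm z}"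
  proof
    fix w assume "w \<in> ball y r"
    then have "cmod (y - w) < r" by (simp add: dist_norm)
    then show "w \<in> {z. 1 < norm z}" using norm_triangle_ineq2[of y "y - w"] y by (simp add: r_def field_simps)
  qed
  have "open (F ` ball y r)"
    by (rule open_mapping_thm3[OF holomorphic_on_subset[OF hol sub] open_ball inj_on_subset[OF inj sub]])
  moreover have "F z \<in> F ` ball y r" using y(2) r by (metis centre_in_ball imageI)
  ultimately obtain e where e: "e > 0" "ball (F z) e \<subseteq> F ` ball y r"
    using open_contains_ball by blast
  obtain d where d: "d > 0" "\<And>y. 1 \<le> cmod y \<Longrightarrow> dist y z < d \<Longrightarrow> dist (F y) (F z) < e"
    using cont z e(1) unfolding continuous_on_iff by force
  obtain v where v: "cmod v > 1" "dist v z < min d r" using near[of "min d r"] d r by auto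
  then have "F v \<in> F ` ball y r" using e(2) d(2)[of v] by (auto simp: dist_commute)
  then obtain v' where v': "v' \<in> ball y r" "F v = F v'" by blast
  then have "v = v'" using inj v(1) sub by (auto dest: inj_onD)
  then have "dist y z < 2 * r" using v' v(2) dist_triangle[of y z v] by auto
  moreover have "dist y z \<ge> cmod y - cmod z" by (simp add: dist_norm norm_triangle_ineq2)
  ultimately show False using z by (simp add: r_def)
qed

text \<open>Reflection in the circle turns \<open>F\<close> into \<open>G\<close>, holomorphic in
  the punctured disc with limit \<open>c\<close> at 0. The extended function has no zeros, so it has
  a logarithm; on the circle \<open>z * cnj (F z) = exp (L z)\<close>.\<close>

lemma exterior_map_logarithm:
  fixes F :: "complex \<Rightarrow> complex" and c :: real
  assumes hol: "F holomorphic_on {z. 1 < norm z}" and cont: "continuous_on {z. 1 \<le> norm z} F"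
    and nz: "\<And>z. 1 \<le> norm z \<Longrightarrow> F z \<noteq> 0"
    and c: "c > 0" "((\<lambda>z. F z / z) \<longlongrightarrow> of_real c) at_infinity"
  obtains L where "continuous_on (cball 0 1) L" "L holomorphic_on ball 0 1" "Im (L 0) = 0"
    "\<And>z. cmod z = 1 \<Longrightarrow> F z = z * exp (cnj (L z))"
proof -
  define G where "G z = z * cnj (F (cnj (1 / z)))" for z
  define g where "g z = (if z = 0 then of_real c else G z)" for z
  have "(cnj \<circ> F \<circ> cnj) holomorphic_on {z. 1 < norm z}"
  proof (rule holomorphic_on_compose_cnj_cnj)
    have "cnj ` {z. 1 < norm z} \<subseteq> {z. 1 < norm z}" by auto
    then show "F holomorphic_on cnj ` {z. 1 < norm z}" by (rule holomorphic_on_subset[OF hol])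
    show "open {z::complex. 1 < norm z}" by (intro open_Collect_less continuous_intros)
  qed
  then have "(\<lambda>z. z * (cnj \<circ> F \<circ> cnj) (1 / z)) holomorphic_on ball 0 1 - {0}"
    by (intro holomorphic_intros holomorphic_on_compose_gen[where g="cnj \<circ> F \<circ> cnj" and f="\<lambda>z. 1/z", unfolded o_def[of _ "\<lambda>z. 1/z"]])
       (auto simp: norm_divide)
  then have holG: "G holomorphic_on ball 0 1 - {0}"
    by (simp add: G_def[abs_def] o_def)
  have "filterlim (\<lambda>z. cnj (1 / z)) at_infinity (at 0)"
  proof -
    have "filterlim (\<lambda>z::complex. inverse z) at_infinity (at 0)" by (rule filterlim_inverse_at_infinity)
    then show ?thesis
      by (simp add: filterlim_at_infinity[OF order.refl] inverse_eq_divide norm_divide)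
  qed
  from filterlim_compose[OF c(2) this]
  have "((\<lambda>z. cnj (F (cnj (1 / z)) / cnj (1 / z))) \<longlongrightarrow> cnj (of_real c)) (at 0)"
    by (rule tendsto_cnj)
  then have "(G \<longlongrightarrow> of_real c) (at 0)"
    by (simp add: G_def[abs_def] divide_simps mult.commute cong: if_cong)
  from removable_singularity[OF holG open_ball this] have holg: "g holomorphic_on ball 0 1"
    by (simp add: g_def[abs_def])
  have "continuous_on (cball 0 1 - {0}) G"
    unfolding G_def
    by (intro continuous_intros continuous_on_compose2[OF cont]) (auto simp: norm_divide)
  then have c1: "continuous_on (cball 0 1 - {0}) g"
    by (rule continuous_on_eq) (auto simp: g_def)
  have c2: "continuous_on (ball 0 1) g" by (rule holomorphic_on_imp_continuous_on[OF holg])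
  have contg: "continuous_on (cball 0 1) g"
    by (rule continuous_on_cball_if_ball[OF c1 c2])
  have nzg: "g z \<noteq> 0" if "z \<in> cball 0 1" for z
    using that nz[of "cnj (1 / z)"] c by (auto simp: g_def G_def norm_divide)
  \<comment> \<open>Two logarithms are compared: \<open>h\<close> is continuous up to the circle,
    \<open>k\<close> is holomorphic inside. Their difference takes values in 2 pi i times the
    integers, hence is constant on the connected disc, and \<open>h\<close> inherits
    holomorphy.\<close>
  obtain h where h: "continuous_on (cball 0 1) h" "\<And>z. z \<in> cball 0 1 \<Longrightarrow> g z = exp (h z)"
    using continuous_logarithm_on_cball[OF contg nzg] by blast
  have cth: "continuous_on (ball 0 1) h" by (rule continuous_on_subset[OF h(1)]) auto
  obtain k where k: "k holomorphic_on ball 0 1" "\<And>z. z \<in> ball 0 1 \<Longrightarrow> g z = exp (k z)"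
    by (rule contractible_imp_holomorphic_log[OF holg])
       (use nzg in \<open>auto intro: convex_imp_contractible\<close>)
  have "(\<lambda>z. h z - k z) constant_on ball 0 1"
  proof (rule continuous_discrete_range_constant)
    show "connected (ball 0 1 :: complex set)" by simp
    show "continuous_on (ball 0 1) (\<lambda>z. h z - k z)"
      by (intro continuous_intros cth holomorphic_on_imp_continuous_on k)
    fix x :: complex assume x: "x \<in> ball 0 1"
    show "\<exists>e>0. \<forall>y. y \<in> ball 0 1 \<and> h y - k y \<noteq> h x - k x \<longrightarrow> e \<le> cmod (h y - k y - (h x - k x))"
    proof (intro exI[of _ 1] conjI allI impI)
      fix y assume y: "y \<in> ball 0 1 \<and> h y - k y \<noteq> h x - k x"
      have "exp (h w - k w) = 1" if "w \<in> ball 0 1" for w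
        using h(2)[of w] k(2)[of w] that by (simp add: exp_diff)
      then have "exp (h y - k y) = exp (h x - k x)" using x y by simp
      then obtain n :: int where n: "h y - k y = h x - k x + of_int (2 * n) * pi * \<i>"
        unfolding exp_eq by blast
      then have "n \<noteq> 0" using y by auto
      then have "\<bar>real_of_int n\<bar> \<ge> 1" by linarith
      moreover have "cmod (h y - k y - (h x - k x)) = 2 * pi * \<bar>real_of_int n\<bar>"
        by (simp add: n norm_mult)
      ultimately show "1 \<le> cmod (h y - k y - (h x - k x))"
        using pi_gt3 mult_mono[of 1 "2 * pi" 1 "\<bar>real_of_int n\<bar>"] by simp
    qed auto
  qed
  then obtain C where "\<And>z. z \<in> ball 0 1 \<Longrightarrow> h z - k z = C"
    unfolding constant_on_def by blast
  then have "k z + C = h z" if "z \<in> ball 0 1" for z using that by (metis add.commute diff_add_cancel)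
  moreover have "(\<lambda>z. k z + C) holomorphic_on ball 0 1" by (intro holomorphic_intros k)
  ultimately have holh: "h holomorphic_on ball 0 1" by (rule holomorphic_transform[rotated])
  \<comment> \<open>As \<open>exp (h 0)\<close> is the positive number \<open>c\<close>, the
    imaginary part of \<open>h 0\<close> is a multiple of 2 pi; subtracting it normalizes the
    logarithm and leaves its exponential unchanged.\<close>
  define L where "L z = h z - \<i> * of_real (Im (h 0))" for z
  have "exp (h 0) = of_real c" using h(2)[of 0] by (simp add: g_def)
  moreover from this have "exp (Re (h 0)) = c" using c(1) by (metis abs_of_pos norm_exp_eq_Re norm_of_real)
  ultimately have one: "exp (\<i> * of_real (Im (h 0))) = 1"
    using exp_eq_polar[of "h 0"] c(1) by (simp add: cis_conv_exp)
  show ?thesis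
  proof
    show "continuous_on (cball 0 1) L" unfolding L_def by (intro continuous_intros h)
    show "L holomorphic_on ball 0 1" unfolding L_def by (intro holomorphic_intros holh)
    show "Im (L 0) = 0" by (simp add: L_def)
    fix z :: complex assume z: "cmod z = 1"
    then have "cnj z * z = 1" by (simp add: complex_norm_square[symmetric] mult.commute)
    then have "cnj (1 / z) = z" and z0: "z \<noteq> 0" by (auto simp: divide_eq_eq mult.commute)
    then have "z * cnj (F z) = g z" by (simp add: g_def G_def)
    also have "\<dots> = exp (L z)" using h(2)[of z] z one by (simp add: L_def exp_diff)
    finally have "cnj z * F z = cnj (exp (L z))" by (metis complex_cnj_cnj complex_cnj_mult)
    then have "z * exp (cnj (L z)) = (cnj z * z) * F z" by (simp add: exp_cnj)
    then show "F z = z * exp (cnj (L z))" by (simp only: \<open>cnj z * z = 1\<close> mult_1)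
  qed
qed

section \<open>The Loewner-Kufarev equation near \<open>t = 0\<close>\<close>

text \<open>Subtracting \<epsilon> t makes the time derivative strictly negative at a positive
  space-time maximum, so the function was larger slightly earlier. Only past times are compared,
  hence the one-sided derivative.\<close>

lemma parabolic_maximum_principle:
  fixes \<Phi> :: "'a::metric_space \<Rightarrow> real \<Rightarrow> real"
  assumes S: "compact S" and cont: "continuous_on (S \<times> {0..b}) (\<lambda>(x, t). \<Phi> x t)"
    and init: "\<And>x. x \<in> S \<Longrightarrow> \<Phi> x 0 \<le> 0"
    and deriv: "\<And>x t. x \<in> S \<Longrightarrow> 0 < t \<Longrightarrow> t \<le> b \<Longrightarrow> (\<And>y. y \<in> S \<Longrightarrow> \<Phi> y t \<le> \<Phi> x t) \<Longrightarrow>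
       \<exists>d\<le>0. (\<Phi> x has_real_derivative d) (at t within {0..t})"
    and x: "x \<in> S" and t: "t \<in> {0..b}"
  shows "\<Phi> x t \<le> 0"
proof (rule ccontr)
  assume "\<not> \<Phi> x t \<le> 0"
  then have pos: "\<Phi> x t > 0" by simp
  \<comment> \<open>Small enough that subtracting \<epsilon> t keeps the value at
    \<open>(x, t)\<close> positive; the \<open>t + 1\<close> avoids dividing by zero when
    \<open>t = 0\<close>.\<close>
  define \<epsilon> where "\<epsilon> = \<Phi> x t / (2 * (t + 1))"
  have eps: "\<epsilon> > 0" using pos t by (simp add: \<epsilon>_def)
  have "\<epsilon> * t < \<Phi> x t"
  proof -
    have "t / (2 * (t + 1)) < 1" using t by simp
    then have "t / (2 * (t + 1)) * \<Phi> x t < 1 * \<Phi> x t" using pos by (rule mult_strict_right_mono)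
    then show ?thesis by (simp add: \<epsilon>_def mult.commute)
  qed
  define \<Psi> where "\<Psi> = (\<lambda>(y, s). \<Phi> y s - \<epsilon> * s)"
  have "continuous_on (S \<times> {0..b}) \<Psi>"
    using continuous_on_diff[OF cont, of "\<lambda>z. \<epsilon> * snd z"]
    by (simp add: \<Psi>_def case_prod_unfold continuous_intros)
  moreover have "compact (S \<times> {0..b})" by (intro compact_Times S compact_Icc)
  moreover have "S \<times> {0..b} \<noteq> {}" using x t by auto
  ultimately have "\<exists>z\<in>S \<times> {0..b}. \<forall>y\<in>S \<times> {0..b}. \<Psi> y \<le> \<Psi> z"
    by (intro continuous_attains_sup)
  then obtain z where z: "z \<in> S \<times> {0..b}" "\<And>y. y \<in> S \<times> {0..b} \<Longrightarrow> \<Psi> y \<le> \<Psi> z"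
    by metis
  obtain y s where zy: "z = (y, s)" "y \<in> S" "0 \<le> s" "s \<le> b" using z(1) by auto
  have max: "\<Phi> y' s' - \<epsilon> * s' \<le> \<Phi> y s - \<epsilon> * s" if "y' \<in> S" "s' \<in> {0..b}" for y' s'
    using z(2)[of "(y', s')"] that zy by (simp add: \<Psi>_def)
  have "\<Phi> y s - \<epsilon> * s > 0" using max[OF x t] \<open>\<epsilon> * t < \<Phi> x t\<close> by linarith
  then have "s \<noteq> 0" using init[OF zy(2)] by auto
  then have s: "0 < s" using zy by simp
  have "\<Phi> y' s \<le> \<Phi> y s" if "y' \<in> S" for y' using max[OF that, of s] zy by simp
  from deriv[OF zy(2) s zy(4) this] obtain d where d: "d \<le> 0" "(\<Phi> y has_real_derivative d) (at s within {0..s})"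
    by blast
  have "((\<lambda>s. \<Phi> y s - \<epsilon> * s) has_real_derivative d - \<epsilon>) (at s within {0..s})"
    by (auto intro!: derivative_eq_intros d(2))
  moreover have "d - \<epsilon> < 0" using d eps by simp
  ultimately obtain e where e: "e > 0"
    "\<And>h. h > 0 \<Longrightarrow> s - h \<in> {0..s} \<Longrightarrow> h < e \<Longrightarrow> \<Phi> y s - \<epsilon> * s < \<Phi> y (s - h) - \<epsilon> * (s - h)"
    using has_real_derivative_neg_dec_left[of "\<lambda>s. \<Phi> y s - \<epsilon> * s" "d - \<epsilon>" s "{0..s}"] by metis
  define h where "h = min (e / 2) s"
  have "h > 0" "h < e" "h \<le> s" using e s by (auto simp: h_def)
  then have "\<Phi> y s - \<epsilon> * s < \<Phi> y (s - h) - \<epsilon> * (s - h)" by (intro e(2)) auto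
  moreover have "\<Phi> y (s - h) - \<epsilon> * (s - h) \<le> \<Phi> y s - \<epsilon> * s"
    using \<open>h > 0\<close> \<open>h \<le> s\<close> zy by (intro max) auto
  ultimately show False by simp
qed

text \<open>Supplies the joint continuity needed for compactness arguments from continuity in time
  and a spatial Lipschitz constant independent of time.\<close>

lemma continuous_on_Times_Lipschitz:
  fixes g :: "'a::metric_space \<Rightarrow> 'b::metric_space \<Rightarrow> 'c::metric_space"
  assumes lip: "\<And>x y t. x \<in> A \<Longrightarrow> y \<in> A \<Longrightarrow> t \<in> B \<Longrightarrow> dist (g x t) (g y t) \<le> K * dist x y"
    and cont: "\<And>x. x \<in> A \<Longrightarrow> continuous_on B (g x)"
  shows "continuous_on (A \<times> B) (\<lambda>(x, t). g x t)"
  unfolding continuous_on_def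
proof safe
  fix x t assume xt: "x \<in> A" "t \<in> B"
  have fst: "((\<lambda>z. fst z) \<longlongrightarrow> x) (at (x, t) within A \<times> B)" and snd: "((\<lambda>z. snd z) \<longlongrightarrow> t) (at (x, t) within A \<times> B)"
    by (auto intro!: tendsto_eq_intros)
  have "((\<lambda>z. g x (snd z)) \<longlongrightarrow> g x t) (at (x, t) within A \<times> B)"
    by (rule continuous_on_tendsto_compose[OF cont[OF xt(1)] snd xt(2)]) (auto simp: eventually_at_filter intro!: always_eventually)
  then have 1: "((\<lambda>z. dist (g x (snd z)) (g x t)) \<longlongrightarrow> 0) (at (x, t) within A \<times> B)"
    by (rule tendsto_dist_iff[THEN iffD1])
  have "((\<lambda>z. K * dist (fst z) x + dist (g x (snd z)) (g x t)) \<longlongrightarrow> K * dist x x + 0) (at (x, t) within A \<times> B)"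
    by (intro tendsto_intros fst 1)
  then have 2: "((\<lambda>z. K * dist (fst z) x + dist (g x (snd z)) (g x t)) \<longlongrightarrow> 0) (at (x, t) within A \<times> B)" by simp
  have "((\<lambda>z. dist (g (fst z) (snd z)) (g x t)) \<longlongrightarrow> 0) (at (x, t) within A \<times> B)"
  proof (rule tendsto_sandwich[OF _ _ tendsto_const 2])
    show "\<forall>\<^sub>F z in at (x, t) within A \<times> B. dist (g (fst z) (snd z)) (g x t) \<le> K * dist (fst z) x + dist (g x (snd z)) (g x t)"
    proof (unfold eventually_at_filter, intro always_eventually allI impI)
      fix z assume "z \<in> A \<times> B"
      then have "dist (g (fst z) (snd z)) (g x (snd z)) \<le> K * dist (fst z) x" using xt by (intro lip) auto
      then show "dist (g (fst z) (snd z)) (g x t) \<le> K * dist (fst z) x + dist (g x (snd z)) (g x t)"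
        using dist_triangle[of "g (fst z) (snd z)" "g x t" "g x (snd z)"] by linarith
    qed
  qed auto
  then show "((\<lambda>(x, t). g x t) \<longlongrightarrow> g x t) (at (x, t) within A \<times> B)"
    by (subst tendsto_dist_iff) (simp add: case_prod_unfold)
qed

section \<open>Spatial Lipschitz bounds and the inward field\<close>

lemma deriv_bound_imp_Lipschitz:
  assumes "g holomorphic_on ball 0 1" "\<And>z. z \<in> ball 0 1 \<Longrightarrow> cmod (deriv g z) \<le> B"
    and "x \<in> ball 0 1" "y \<in> ball 0 1"
  shows "cmod (g x - g y) \<le> B * cmod (x - y)"
  by (rule field_differentiable_bound[of "ball 0 1" g "deriv g"])
     (use assms in \<open>auto intro: holomorphic_derivI\<close>)

text \<open>Cauchy's estimate on discs of radius \<open>(1 - r) / 2\<close>, which stay inside the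
  unit disc. The constant depends on \<open>r\<close> only, so it serves all times at once.\<close>

lemma bounded_holomorphic_Lipschitz_cball:
  assumes "g holomorphic_on ball 0 1" "\<And>z. z \<in> ball 0 1 \<Longrightarrow> cmod (g z) \<le> 1"
    and r: "0 \<le> r" "r < 1" and "x \<in> cball 0 r" "y \<in> cball 0 r"
  shows "cmod (g x - g y) \<le> 2 / (1 - r) * cmod (x - y)"
proof (rule field_differentiable_bound[of "cball 0 r" g "deriv g"])
  show "(g has_field_derivative deriv g z) (at z within cball 0 r)" if "z \<in> cball 0 r" for z
    using that r assms(1) by (intro DERIV_subset[OF holomorphic_derivI[of g "ball 0 1"]]) auto
  show "cmod (deriv g z) \<le> 2 / (1 - r)" if z: "z \<in> cball 0 r" for z
  proof -
    have sub: "cball z ((1 - r) / 2) \<subseteq> ball 0 1"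
    proof
      fix w assume "w \<in> cball z ((1 - r) / 2)"
      then have "cmod (w - z) \<le> (1 - r) / 2" by (simp add: dist_norm norm_minus_commute)
      then show "w \<in> ball 0 1" using norm_triangle_sub[of w z] z r by (simp add: field_simps)
    qed
    have "cmod ((deriv ^^ 1) g z) \<le> fact 1 * 1 / ((1 - r) / 2) ^ 1"
    proof (rule Cauchy_inequality)
      show "g holomorphic_on ball z ((1 - r) / 2)"
        using sub by (intro holomorphic_on_subset[OF assms(1)]) (meson ball_subset_cball order_trans)
      show "continuous_on (cball z ((1 - r) / 2)) g"
        using sub by (intro holomorphic_on_imp_continuous_on holomorphic_on_subset[OF assms(1)])
      show "cmod (g w) \<le> 1" if "cmod (z - w) = (1 - r) / 2" for w
        using subsetD[OF sub, of w] that by (intro assms(2)) (simp add: dist_norm)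
    qed (use r in auto)
    then show ?thesis by simp
  qed
qed (use assms in auto)

text \<open>Positivity of \<open>Re P\<close> gives \<open>|1 - s P| \<le> 1\<close> as soon as
  \<open>s |P|\<^sup>2 \<le> 2 Re P\<close>. Thus moving along \<open>- z P\<close> is admissible
  even from the boundary of the compact disc, where a maximum may sit.\<close>

lemma inward_flow_stays_in_cball:
  fixes a P :: complex
  assumes "Re P > 0" "a \<in> cball 0 r"
  shows "\<forall>\<^sub>F s in at_right 0. a - of_real s * (a * P) \<in> cball 0 r"
proof -
  have P: "cmod P > 0" using assms(1) by auto
  have "\<forall>\<^sub>F s in at_right 0. 0 < s \<and> s < 2 * Re P / (cmod P)\<^sup>2"
    unfolding eventually_at_right_field using assms(1) P
    by (intro exI[of _ "2 * Re P / (cmod P)\<^sup>2"]) simp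
  then show ?thesis
  proof eventually_elim
    case (elim s)
    have "(cmod (1 - of_real s * P))\<^sup>2 = 1 - s * (2 * Re P - s * (cmod P)\<^sup>2)"
      unfolding cmod_power2 by (simp add: power2_eq_square algebra_simps)
    moreover have "s * (cmod P)\<^sup>2 \<le> 2 * Re P" using elim P by (simp add: pos_less_divide_eq)
    ultimately have "(cmod (1 - of_real s * P))\<^sup>2 \<le> 1\<^sup>2" using elim by simp
    then have "cmod (1 - of_real s * P) \<le> 1" by (rule power2_le_imp_le) simp
    then have "cmod a * cmod (1 - of_real s * P) \<le> cmod a * 1" by (intro mult_left_mono) auto
    moreover have "a - of_real s * (a * P) = a * (1 - of_real s * P)" by (simp add: algebra_simps)
    ultimately show ?case using assms(2) by (simp add: norm_mult)
  qed
qed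

lemma right_derivative_nonpos_at_max:
  fixes g :: "real \<Rightarrow> real"
  assumes "(g has_real_derivative d) (at 0)" "\<forall>\<^sub>F s in at_right 0. g s \<le> g 0"
  shows "d \<le> 0"
proof (rule ccontr)
  assume "\<not> d \<le> 0"
  then obtain e where "e > 0" "\<And>h. 0 < h \<Longrightarrow> h < e \<Longrightarrow> g 0 < g (0 + h)"
    using has_real_derivative_pos_inc_right[of g d 0 UNIV] assms(1) by auto
  then have "\<forall>\<^sub>F s in at_right 0. g 0 < g s" by (auto simp: eventually_at_right_field)
  with assms(2) have "\<forall>\<^sub>F s in at_right (0::real). False"
    by eventually_elim simp
  then show False by simp
qed

text \<open>
  A maximum principle for \<open>\<Phi> = e\<^bsup>-t/t\<^sub>0\<^esup>|u(a,t) - u(b,t)|\<^sup>2 - 2C\<^sup>2t\<^sub>0t|a - b|\<^sup>2\<close> with \<open>u = f - z\<close>: moving both points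
  along the inward field \<open>- z p\<close> at a spatial maximum bounds exactly the transport part of \<open>\<partial>\<Phi>/\<partial>t\<close>. No characteristics are needed.
\<close>
lemma Loewner_Kufarev_displacement_Lipschitz:
  fixes p f :: "complex \<Rightarrow> real \<Rightarrow> complex"
  assumes p_hol: "\<And>t. t \<in> {0..<T} \<Longrightarrow> (\<lambda>z. p z t) holomorphic_on ball 0 1"
    and p_Re: "\<And>t z. t \<in> {0..<T} \<Longrightarrow> z \<in> ball 0 1 \<Longrightarrow> Re (p z t) > 0"
    and p_le: "\<And>t z. t \<in> {0..<T} \<Longrightarrow> z \<in> ball 0 1 \<Longrightarrow> cmod (p z t) \<le> M"
    and p'_le: "\<And>t z. t \<in> {0..<T} \<Longrightarrow> z \<in> ball 0 1 \<Longrightarrow> cmod (deriv (\<lambda>z. p z t) z) \<le> M"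
    and f_hol: "\<And>t. t \<in> {0..<T} \<Longrightarrow> (\<lambda>z. f z t) holomorphic_on ball 0 1"
    and f_le: "\<And>t z. t \<in> {0..<T} \<Longrightarrow> z \<in> ball 0 1 \<Longrightarrow> cmod (f z t) \<le> 1"
    and LK: "\<And>t z. t \<in> {0..<T} \<Longrightarrow> z \<in> ball 0 1 \<Longrightarrow>
       ((\<lambda>s. f z s) has_vector_derivative (- z * deriv (\<lambda>w. f w t) z * p z t)) (at t within {0..<T})"
    and f_init: "\<And>z. z \<in> ball 0 1 \<Longrightarrow> f z 0 = z"
    and t0: "0 < t0" "t0 < T" "8 * M * t0 \<le> 1"
    and z1: "z1 \<in> ball 0 1" and z2: "z2 \<in> ball 0 1"
  shows "cmod ((f z1 t0 - z1) - (f z2 t0 - z2)) \<le> 6 * M * t0 * cmod (z1 - z2)"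
proof -
  \<comment> \<open>A Lipschitz constant of \<open>z * p z t\<close> in \<open>z\<close>: one
    \<open>M\<close> comes from the bound on \<open>p\<close>, the other from the bound on its
    derivative.\<close>
  define C where "C = 2 * M"
  have M0: "M \<ge> 0" using p_le[of 0 0] t0 by (auto intro: order_trans[OF norm_ge_zero])
  then have C0: "C \<ge> 0" by (simp add: C_def)
  have zp_lip: "cmod (a * p a t - b * p b t) \<le> C * cmod (a - b)"
    if t: "t \<in> {0..<T}" and ab: "a \<in> ball 0 1" "b \<in> ball 0 1" for a b t
  proof -
    have 1: "cmod (p a t - p b t) \<le> M * cmod (a - b)"
      by (rule deriv_bound_imp_Lipschitz[OF p_hol[OF t] p'_le[OF t]]) (use ab in auto)
    have "a * p a t - b * p b t = (a - b) * p a t + b * (p a t - p b t)" by (simp add: algebra_simps)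
    then have "cmod (a * p a t - b * p b t) \<le> cmod (a - b) * cmod (p a t) + cmod b * cmod (p a t - p b t)"
      by (metis norm_mult norm_triangle_ineq)
    also have "\<dots> \<le> cmod (a - b) * M + 1 * (M * cmod (a - b))"
      using ab p_le[OF t ab(1)] by (intro add_mono mult_mono 1) auto
    finally show ?thesis by (simp add: C_def)
  qed
  \<comment> \<open>The argument runs on a compact subdisc containing both points; the resulting
    constant does not involve \<open>r\<close>.\<close>
  define r where "r = max (cmod z1) (cmod z2)"
  have r: "0 \<le> r" "r < 1" using z1 z2 by (auto simp: r_def le_max_iff_disj)
  have in_ball: "x \<in> ball 0 1" if "x \<in> cball 0 r" for x :: complex using that r by auto
  define S where "S = cball (0::complex) r \<times> cball (0::complex) r"
  define D where "D x t = (f (fst x) t - fst x) - (f (snd x) t - snd x)" for x t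
  define \<Phi> where "\<Phi> x t = exp (- t / t0) * (D x t \<bullet> D x t) - 2 * C\<^sup>2 * t0 * t * ((fst x - snd x) \<bullet> (fst x - snd x))"
    for x t
  have sub: "{0..t0} \<subseteq> {0..<T}" using t0 by auto
  have "continuous_on (cball 0 r \<times> {0..t0}) (\<lambda>(z, t). f z t)"
  proof (rule continuous_on_Times_Lipschitz)
    show "dist (f x t) (f y t) \<le> 2 / (1 - r) * dist x y"
      if "x \<in> cball 0 r" "y \<in> cball 0 r" "t \<in> {0..t0}" for x y t
      unfolding dist_norm
      by (rule bounded_holomorphic_Lipschitz_cball[OF f_hol f_le]) (use that r sub in auto)
    show "continuous_on {0..t0} (f z)" if "z \<in> cball 0 r" for z
      using continuous_on_vector_derivative[OF LK[OF _ in_ball[OF that]]] sub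
      by (rule continuous_on_subset)
  qed
  then have cf1: "continuous_on (cball 0 r \<times> {0..t0}) (\<lambda>y. f (fst y) (snd y))"
    by (simp add: case_prod_unfold)
  have cf: "continuous_on (S \<times> {0..t0}) (\<lambda>y. f (fst (fst y)) (snd y))"
    "continuous_on (S \<times> {0..t0}) (\<lambda>y. f (snd (fst y)) (snd y))"
    using continuous_on_compose2[OF cf1, of "S \<times> {0..t0}" "\<lambda>y. (fst (fst y), snd y)"]
      continuous_on_compose2[OF cf1, of "S \<times> {0..t0}" "\<lambda>y. (snd (fst y), snd y)"]
    by (force simp: S_def intro!: continuous_intros)+
  have cont: "continuous_on (S \<times> {0..t0}) (\<lambda>(x, t). \<Phi> x t)"
    unfolding \<Phi>_def D_def case_prod_unfold using t0
    by (intro continuous_intros cf) auto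
  have main: "\<Phi> x t \<le> 0" if xt: "x \<in> S" "t \<in> {0..t0}" for x t
  proof (rule parabolic_maximum_principle[OF _ cont _ _ xt])
    show "compact S" unfolding S_def by (intro compact_Times compact_cball)
    show "\<Phi> x 0 \<le> 0" if "x \<in> S" for x
      using that f_init in_ball by (auto simp: \<Phi>_def D_def S_def)
    fix x t assume x: "x \<in> S" and t: "0 < t" "t \<le> t0" and max: "\<And>y. y \<in> S \<Longrightarrow> \<Phi> y t \<le> \<Phi> x t"
    obtain a b where ab: "x = (a, b)" "a \<in> cball 0 r" "b \<in> cball 0 r" using x by (auto simp: S_def)
    have tT: "t \<in> {0..<T}" using t t0 by auto
    \<comment> \<open>\<open>V z\<close> is the time derivative of \<open>f\<close>, and it equals
      the spatial derivative of \<open>f\<close> in the direction \<open>h z\<close>. This identity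
      is what couples the two kinds of derivative below.\<close>
    define V where "V z = - z * deriv (\<lambda>w. f w t) z * p z t" for z
    define h where "h z = - (z * p z t)" for z
    define H where "H = h a - h b"
    define D' where "D' = V a - V b"
    define \<kappa> where "\<kappa> = exp (- t / t0)"
    define d where "d = - (1 / t0) * \<kappa> * (D x t \<bullet> D x t) + \<kappa> * (2 * (D x t \<bullet> D')) - 2 * C\<^sup>2 * t0 * ((a - b) \<bullet> (a - b))"
    have fd: "((\<lambda>s. f z s) has_vector_derivative V z) (at t within {0..t})" if "z \<in> cball 0 r" for z
      unfolding V_def using tT by (intro has_vector_derivative_within_subset[OF LK[OF tT in_ball[OF that]]]) auto
    have Dd: "((\<lambda>s. D x s) has_vector_derivative D') (at t within {0..t})"
      unfolding D_def D'_def ab by (auto intro!: derivative_eq_intros fd ab)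
    have "((\<lambda>s. D x s \<bullet> D x s) has_vector_derivative (D x t \<bullet> D' + D' \<bullet> D x t)) (at t within {0..t})"
      by (rule bounded_bilinear.has_vector_derivative[OF bounded_bilinear_inner Dd Dd])
    then have DD: "((\<lambda>s. D x s \<bullet> D x s) has_real_derivative 2 * (D x t \<bullet> D')) (at t within {0..t})"
      by (simp add: has_real_derivative_iff_has_vector_derivative inner_commute)
    have "(\<Phi> x has_real_derivative d) (at t within {0..t})"
      unfolding \<Phi>_def d_def \<kappa>_def ab(1)[symmetric] using t0
      by (auto intro!: derivative_eq_intros DD[unfolded ab] simp: ab)
    moreover have "d \<le> 0"
    proof -
      have ray: "((\<lambda>s. z + s *\<^sub>R h z) has_vector_derivative h z) (at 0)" for z
        using has_vector_derivative_add[OF has_vector_derivative_const[of z]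
          has_vector_derivative_scaleR[OF DERIV_ident has_vector_derivative_const[of "h z"]]] by simp
      have uh: "((\<lambda>s. f (z + s *\<^sub>R h z) t) has_vector_derivative V z) (at 0)" if "z \<in> cball 0 r" for z
      proof -
        have "((\<lambda>w. f w t) has_field_derivative deriv (\<lambda>w. f w t) z) (at (z + 0 *\<^sub>R h z))"
          using in_ball[OF that] f_hol[OF tT] by (simp add: holomorphic_derivI)
        moreover note ray[of z]
        ultimately have "((\<lambda>w. f w t) \<circ> (\<lambda>s. z + s *\<^sub>R h z) has_vector_derivative h z * deriv (\<lambda>w. f w t) z) (at 0)"
          by (intro field_vector_diff_chain_at)
        then show ?thesis by (simp add: o_def V_def h_def mult_ac)
      qed
      \<comment> \<open>The competitor curve moves both points along the inward field. Along it
        \<open>D\<close> has derivative \<open>D' - H\<close>: the \<open>f\<close> parts give the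
        time derivative \<open>D'\<close>, the identity parts give \<open>H\<close>.\<close>
      define y where "y s = (a + s *\<^sub>R h a, b + s *\<^sub>R h b)" for s
      have y0: "y 0 = x" by (simp add: y_def ab)
      have yd: "((\<lambda>s. D (y s) t) has_vector_derivative D' - H) (at 0)"
      proof -
        have "((\<lambda>s. D (y s) t) has_vector_derivative (V a - h a) - (V b - h b)) (at 0)"
          unfolding D_def y_def fst_conv snd_conv by (intro has_vector_derivative_diff uh ab ray)
        then show ?thesis by (simp add: D'_def H_def algebra_simps)
      qed
      have "((\<lambda>s. D (y s) t \<bullet> D (y s) t) has_vector_derivative (D (y 0) t \<bullet> (D' - H) + (D' - H) \<bullet> D (y 0) t)) (at 0)"
        by (rule bounded_bilinear.has_vector_derivative[OF bounded_bilinear_inner yd yd])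
      then have DD: "((\<lambda>s. D (y s) t \<bullet> D (y s) t) has_real_derivative 2 * (D x t \<bullet> (D' - H))) (at 0)"
        by (simp add: has_real_derivative_iff_has_vector_derivative inner_commute y0)
      have yd: "((\<lambda>s. fst (y s) - snd (y s)) has_vector_derivative H) (at 0)"
        unfolding y_def H_def fst_conv snd_conv by (intro has_vector_derivative_diff ray)
      have "((\<lambda>s. (fst (y s) - snd (y s)) \<bullet> (fst (y s) - snd (y s))) has_vector_derivative
          ((fst (y 0) - snd (y 0)) \<bullet> H + H \<bullet> (fst (y 0) - snd (y 0)))) (at 0)"
        by (rule bounded_bilinear.has_vector_derivative[OF bounded_bilinear_inner yd yd])
      then have AA: "((\<lambda>s. (fst (y s) - snd (y s)) \<bullet> (fst (y s) - snd (y s))) has_real_derivative 2 * ((a - b) \<bullet> H)) (at 0)"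
        by (simp add: has_real_derivative_iff_has_vector_derivative inner_commute y0 ab)
      have "((\<lambda>s. \<Phi> (y s) t) has_real_derivative
          \<kappa> * (2 * (D x t \<bullet> (D' - H))) - 2 * C\<^sup>2 * t0 * t * (2 * ((a - b) \<bullet> H))) (at 0)"
        unfolding \<Phi>_def \<kappa>_def by (intro DERIV_diff DERIV_cmult DD AA)
      moreover have "\<forall>\<^sub>F s in at_right 0. \<Phi> (y s) t \<le> \<Phi> (y 0) t"
        using inward_flow_stays_in_cball[OF p_Re[OF tT in_ball[OF ab(2)]] ab(2)]
          inward_flow_stays_in_cball[OF p_Re[OF tT in_ball[OF ab(3)]] ab(3)]
      proof eventually_elim
        case (elim s)
        then have "y s \<in> S" by (simp add: y_def S_def h_def scaleR_conv_of_real)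
        then show ?case using max y0 by simp
      qed
      ultimately have "\<kappa> * (2 * (D x t \<bullet> (D' - H))) - 2 * C\<^sup>2 * t0 * t * (2 * ((a - b) \<bullet> H)) \<le> 0"
        by (rule right_derivative_nonpos_at_max)
      \<comment> \<open>Maximality along the curve trades the uncontrolled term in
        \<open>D'\<close>, which contains the derivative of \<open>f\<close>, for terms in
        \<open>H\<close>, which are controlled by \<open>C\<close>.\<close>
      then have 1: "\<kappa> * (2 * (D x t \<bullet> D')) \<le> \<kappa> * (2 * (D x t \<bullet> H)) + 4 * C\<^sup>2 * t0 * t * ((a - b) \<bullet> H)"
        by (simp add: inner_diff_right algebra_simps)
      have HC: "norm H \<le> C * norm (a - b)"
        using zp_lip[OF tT in_ball[OF ab(3)] in_ball[OF ab(2)]] by (simp add: H_def h_def norm_minus_commute)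
      define A where "A = norm (a - b)"
      define B where "B = norm (D x t)"
      have AB: "A \<ge> 0" "B \<ge> 0" by (auto simp: A_def B_def)
      have k: "0 < \<kappa>" "\<kappa> \<le> 1" using t t0 by (auto simp: \<kappa>_def)
      have "D x t \<bullet> H \<le> B * (C * A)"
        using norm_cauchy_schwarz[of "D x t" H] mult_left_mono[OF HC AB(2)] by (simp add: B_def A_def)
      \<comment> \<open>Young's inequality with weight \<open>t0\<close>, so that the term in
        \<open>B\<close> is exactly cancelled by the derivative of the exponential factor.\<close>
      moreover have "2 * (B * (C * A)) \<le> B\<^sup>2 / t0 + C\<^sup>2 * t0 * A\<^sup>2"
      proof -
        have "0 \<le> (B - C * t0 * A)\<^sup>2 / t0" using t0 by simp
        also have "\<dots> = B\<^sup>2 / t0 + C\<^sup>2 * t0 * A\<^sup>2 - 2 * (B * (C * A))"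
          using t0 by (simp add: power2_eq_square field_simps)
        finally show ?thesis by simp
      qed
      ultimately have "\<kappa> * (2 * (D x t \<bullet> H)) \<le> \<kappa> * (B\<^sup>2 / t0 + C\<^sup>2 * t0 * A\<^sup>2)"
        using k by (intro mult_left_mono) auto
      also have "\<dots> \<le> \<kappa> * (B\<^sup>2 / t0) + C\<^sup>2 * t0 * A\<^sup>2"
        using k t0 by (simp add: distrib_left mult_left_le_one_le)
      finally have 2: "\<kappa> * (2 * (D x t \<bullet> H)) \<le> \<kappa> * (B\<^sup>2 / t0) + C\<^sup>2 * t0 * A\<^sup>2" .
      have "(a - b) \<bullet> H \<le> A * (C * A)"
        using norm_cauchy_schwarz[of "a - b" H] mult_left_mono[OF HC AB(1)] by (simp add: A_def)
      then have "4 * C\<^sup>2 * t0 * t * ((a - b) \<bullet> H) \<le> 4 * C\<^sup>2 * t0 * t * (A * (C * A))"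
        using t t0 by (intro mult_left_mono) auto
      also have "\<dots> = (4 * C * t) * (C\<^sup>2 * t0 * A\<^sup>2)" by (simp add: power2_eq_square)
      \<comment> \<open>The smallness \<open>8 * M * t0 \<le> 1\<close> is used here, since
        \<open>4 * C * t\<close> is \<open>8 * M * t\<close>.\<close>
      also have "\<dots> \<le> 1 * (C\<^sup>2 * t0 * A\<^sup>2)"
      proof (rule mult_right_mono)
        have "4 * C * t \<le> 4 * C * t0" using t C0 by (intro mult_left_mono) auto
        then show "4 * C * t \<le> 1" using t0 by (simp add: C_def)
      qed (use t0 in auto)
      finally have 3: "4 * C\<^sup>2 * t0 * t * ((a - b) \<bullet> H) \<le> C\<^sup>2 * t0 * A\<^sup>2" by simp
      \<comment> \<open>Young's inequality and the motion of the penalty term each cost one copy of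
        \<open>C\<^sup>2 * t0 * A\<^sup>2\<close>; the factor 2 in the penalty of \<Phi> pays for
        both.\<close>
      have "d = - (\<kappa> * (B\<^sup>2 / t0)) + \<kappa> * (2 * (D x t \<bullet> D')) - 2 * (C\<^sup>2 * t0 * A\<^sup>2)"
        by (simp add: d_def A_def B_def power2_norm_eq_inner)
      then show "d \<le> 0" using 1 2 3 by linarith
    qed
    ultimately show "\<exists>d\<le>0. (\<Phi> x has_real_derivative d) (at t within {0..t})" by blast
  qed
  define N where "N = cmod (D (z1, z2) t0)"
  define A where "A = cmod (z1 - z2)"
  have "\<Phi> (z1, z2) t0 \<le> 0"
    using t0 by (intro main) (auto simp: S_def r_def)
  then have "exp (-1) * N\<^sup>2 \<le> 2 * C\<^sup>2 * t0 * t0 * A\<^sup>2"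
    using t0 by (simp add: \<Phi>_def N_def A_def power2_norm_eq_inner)
  then have "N\<^sup>2 \<le> exp 1 * (2 * C\<^sup>2 * t0 * t0 * A\<^sup>2)"
    by (simp add: exp_minus pos_divide_le_eq[of "exp 1"] inverse_eq_divide mult.commute)
  \<comment> \<open>At \<open>t = t0\<close> the exponential weight is 1/e. Replacing e by 9/2 makes
    the constant the square of 3, and \<open>3 * C = 6 * M\<close>.\<close>
  also have "\<dots> \<le> 9 / 2 * (2 * C\<^sup>2 * t0 * t0 * A\<^sup>2)"
    using e_less_272 t0 by (intro mult_right_mono) auto
  also have "\<dots> = (3 * C * t0 * A)\<^sup>2"
    by (simp add: power_mult_distrib power2_eq_square[of t0])
  finally have "N \<le> 3 * C * t0 * A"
    by (rule power2_le_imp_le) (use C0 t0 in \<open>simp add: A_def\<close>)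
  then show ?thesis by (simp add: N_def A_def D_def C_def)
qed

section \<open>Asymptotics\<close>

lemma norm_exp_minus_one_le:
  fixes x :: complex
  assumes "cmod x \<le> 1"
  shows "cmod (exp x - 1) \<le> 3 * cmod x"
proof -
  have "cmod (exp x - exp 0) \<le> 3 * cmod (x - 0)"
  proof (rule field_differentiable_bound[of "cball 0 1" exp exp])
    show "cmod (exp z) \<le> 3" if "z \<in> cball 0 1" for z :: complex
    proof -
      have "cmod (exp z) \<le> exp (cmod z)" by (rule norm_exp)
      also have "\<dots> \<le> exp 1" using that by simp
      also have "\<dots> \<le> 3" using e_less_272 by simp
      finally show ?thesis .
    qed
  qed (use assms in \<open>auto intro!: derivative_eq_intros\<close>)
  then show ?thesis by simp
qed

lemma Ln_Lipschitz_near_1: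
  assumes "cmod (x - 1) \<le> 1/2" "cmod (y - 1) \<le> 1/2"
  shows "cmod (Ln x - Ln y) \<le> 2 * cmod (x - y)"
proof (rule field_differentiable_bound[of "cball 1 (1/2)" Ln inverse])
  fix z :: complex assume "z \<in> cball 1 (1/2)"
  then have z: "cmod (1 - z) \<le> 1/2" by (simp add: dist_norm)
  have "Re z \<ge> 1/2" using z abs_Re_le_cmod[of "1 - z"] by simp
  then show "(Ln has_field_derivative inverse z) (at z within cball 1 (1/2))"
    by (intro has_field_derivative_at_within[OF has_field_derivative_Ln]) (simp add: complex_nonpos_Reals_iff)
  have "cmod z \<ge> 1/2" using z norm_triangle_ineq2[of 1 "1 - z"] by simp
  then show "cmod (inverse z) \<le> 2" using le_imp_inverse_le[of "1/2" "cmod z"] by (simp add: norm_inverse)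
qed (use assms in \<open>auto simp: dist_norm norm_minus_commute\<close>)

lemma Lipschitz_imp_deriv_bound:
  fixes g :: "complex \<Rightarrow> complex"
  assumes g: "(g has_field_derivative g') (at z)" and "open S" "z \<in> S"
    and lip: "\<And>w. w \<in> S \<Longrightarrow> cmod (g w - g z) \<le> B * cmod (w - z)"
  shows "cmod g' \<le> B"
proof (rule tendsto_upperbound)
  show "((\<lambda>w. cmod ((g w - g z) / (w - z))) \<longlongrightarrow> cmod g') (at z)"
    using g by (intro tendsto_norm) (simp add: has_field_derivative_iff)
  show "\<forall>\<^sub>F w in at z. cmod ((g w - g z) / (w - z)) \<le> B"
    using eventually_at_in_open[OF assms(2,3)]
    by (rule eventually_mono) (use lip in \<open>simp add: norm_divide pos_divide_le_eq\<close>)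
qed simp

text \<open>Mean value inequality in time for \<open>f - z\<close> plus the expected linear term.
  Its derivative is small for two reasons: \<open>p\<close> has barely moved from time 0, and
  \<open>f' - 1\<close> is bounded by the Lipschitz constant \<open>B\<close> of
  \<open>f - z\<close>.\<close>

lemma Loewner_Kufarev_first_order:
  fixes p f :: "complex \<Rightarrow> real \<Rightarrow> complex"
  assumes M: "\<And>t z. t \<in> {0..<T} \<Longrightarrow> z \<in> ball 0 1 \<Longrightarrow> cmod (p z t) \<le> M"
    and f_hol: "\<And>t. t \<in> {0..<T} \<Longrightarrow> (\<lambda>z. f z t) holomorphic_on ball 0 1"
    and LK: "\<And>t z. t \<in> {0..<T} \<Longrightarrow> z \<in> ball 0 1 \<Longrightarrow>
       ((\<lambda>s. f z s) has_vector_derivative (- z * deriv (\<lambda>w. f w t) z * p z t)) (at t within {0..<T})"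
    and f_init: "\<And>z. z \<in> ball 0 1 \<Longrightarrow> f z 0 = z"
    and lip: "\<And>s w w'. 0 < s \<Longrightarrow> s < t \<Longrightarrow> w \<in> ball 0 1 \<Longrightarrow> w' \<in> ball 0 1 \<Longrightarrow>
       cmod ((f w s - w) - (f w' s - w')) \<le> B * cmod (w - w')"
    and t: "0 < t" "t < T"
    and near: "\<And>s. 0 < s \<Longrightarrow> s < t \<Longrightarrow> cmod (p z s - p z 0) \<le> e"
    and z: "z \<in> ball 0 1"
  shows "cmod (f z t - z + of_real t * (z * p z 0)) \<le> t * (e + B * M)"
proof -
  have M0: "M \<ge> 0" using M[of 0 z] t z by (auto intro: order_trans[OF norm_ge_zero])
  define g where "g s = f z s - z + s *\<^sub>R (z * p z 0)" for s
  define g' where "g' s = - z * deriv (\<lambda>w. f w s) z * p z s + z * p z 0" for s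
  have "norm (g t - g 0) \<le> (e + B * M) * t - (e + B * M) * 0"
  proof (rule differentiable_bound_general[OF t(1), where f' = g' and \<phi>' = "\<lambda>_. e + B * M"])
    have "continuous_on {0..<T} (f z)" by (rule continuous_on_vector_derivative[OF LK[OF _ z]])
    then have "continuous_on {0..t} (f z)" by (rule continuous_on_subset) (use t in auto)
    then show "continuous_on {0..t} g" unfolding g_def by (intro continuous_intros)
    show "continuous_on {0..t} (\<lambda>s. (e + B * M) * s)" by (intro continuous_intros)
    fix s assume s: "0 < s" "s < t"
    then have sT: "s \<in> {0..<T}" and int: "s \<in> interior {0..<T}" using t by auto
    have "((\<lambda>s. f z s) has_vector_derivative (- z * deriv (\<lambda>w. f w s) z * p z s)) (at s)"
      using LK[OF sT z] by (simp only: at_within_interior[OF int])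
    from has_vector_derivative_add[OF has_vector_derivative_diff[OF this has_vector_derivative_const[of z]]
          has_vector_derivative_scaleR[OF DERIV_ident has_vector_derivative_const[of "z * p z 0"]]]
    show "(g has_vector_derivative g' s) (at s)" unfolding g_def g'_def by simp
    show "((\<lambda>s. (e + B * M) * s) has_vector_derivative e + B * M) (at s)"
      by (auto intro!: derivative_eq_intros simp flip: has_real_derivative_iff_has_vector_derivative)
    have d: "((\<lambda>w. f w s - w) has_field_derivative deriv (\<lambda>w. f w s) z - 1) (at z)"
      by (intro derivative_intros holomorphic_derivI[OF f_hol[OF sT] _ z]) auto
    have fd: "cmod (deriv (\<lambda>w. f w s) z - 1) \<le> B"
      by (rule Lipschitz_imp_deriv_bound[OF d open_ball z]) (use lip[OF s] z in blast)
    have B0: "B \<ge> 0" using fd norm_ge_zero order_trans by blast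
    have "g' s = z * ((p z 0 - p z s) - (deriv (\<lambda>w. f w s) z - 1) * p z s)"
      by (simp add: g'_def algebra_simps)
    then have "norm (g' s) = cmod z * cmod ((p z 0 - p z s) - (deriv (\<lambda>w. f w s) z - 1) * p z s)"
      by (simp add: norm_mult)
    also have "\<dots> \<le> 1 * (cmod (p z 0 - p z s) + cmod (deriv (\<lambda>w. f w s) z - 1) * cmod (p z s))"
      using z norm_triangle_ineq4[of "p z 0 - p z s" "(deriv (\<lambda>w. f w s) z - 1) * p z s"]
      by (intro mult_mono) (auto simp: norm_mult)
    also have "\<dots> \<le> 1 * (e + B * M)"
      using near[OF s] M[OF sT z] B0 fd by (intro mult_left_mono add_mono mult_mono) (auto simp: norm_minus_commute)
    finally show "norm (g' s) \<le> e + B * M" by simp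
  qed
  then show ?thesis using f_init[OF z] by (simp add: g_def scaleR_conv_of_real mult.commute)
qed

text \<open>The sup bound is applied twice: first to \<open>L\<close>, giving its size and hence the
  closeness of welded points, then to \<open>E = L + t P\<close>, whose real part on the circle is
  then small. The cutoff \<open>N\<close> stays free so that it can be fixed before \<delta> is made
  small.\<close>

lemma welding_asymptotics:
  fixes L P q :: "complex \<Rightarrow> complex" and N :: nat
  assumes L: "continuous_on (cball 0 1) L" "L holomorphic_on ball 0 1" "Im (L 0) = 0"
    and weld: "\<And>z. cmod z = 1 \<Longrightarrow> \<exists>w. cmod w = 1 \<and> w * exp (q w) = z * exp (cnj (L z))"
    and q_lip: "\<And>w w'. cmod w = 1 \<Longrightarrow> cmod w' = 1 \<Longrightarrow> cmod (q w' - q w) \<le> \<epsilon> * cmod (w' - w)"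
    and q_le: "\<And>w. cmod w = 1 \<Longrightarrow> cmod (q w) \<le> \<epsilon>" and eps: "\<epsilon> \<le> 1/16"
    and P: "continuous_on (cball 0 1) P" "P holomorphic_on ball 0 1" "Im (P 0) = 0"
    and P_lip: "\<And>x y. x \<in> cball 0 1 \<Longrightarrow> y \<in> cball 0 1 \<Longrightarrow> cmod (P x - P y) \<le> M * cmod (x - y)"
    and t: "0 \<le> t" and q_asym: "\<And>w. cmod w = 1 \<Longrightarrow> cmod (q w + of_real t * P w) \<le> \<delta>"
    and N: "N \<ge> 1"
  shows "z \<in> cball 0 1 \<Longrightarrow> cmod (L z) \<le> 8 * \<epsilon>"
    and "z \<in> cball 0 1 \<Longrightarrow> cmod (L z + of_real t * P z) \<le> (1 + 3 * sqrt N) * (\<delta> + 27 * t * M * \<epsilon>) + (6 * \<epsilon> + 2 * t * M) / sqrt N"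
proof -
  have e0: "\<epsilon> \<ge> 0" using q_le[of 1] order_trans[OF norm_ge_zero] by auto
  have M0: "M \<ge> 0" using P_lip[of 1 0] order_trans[OF norm_ge_zero, of "P 1 - P 0" "M"] by simp
  define a where "a n = (deriv ^^ n) L 0 / fact n" for n
  have La: "(\<lambda>n. a n * z ^ n) sums L z" if "z \<in> ball 0 1" for z
    using holomorphic_power_series[OF L(2) that] by (simp add: a_def)
  define b where "b n = (deriv ^^ n) P 0 / fact n" for n
  have Pb: "(\<lambda>n. b n * z ^ n) sums P z" if "z \<in> ball 0 1" for z
    using holomorphic_power_series[OF P(2) that] by (simp add: b_def)
  have DL: "\<forall>\<^sub>F h in at_right 0.
      integral {0..2*pi} (\<lambda>x. (cmod (L (cis h * cis x) - L (cis x)))\<^sup>2) \<le> 2 * pi * (4 * \<epsilon>)\<^sup>2 * h\<^sup>2"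
    by (rule welding_square_bound[OF L(1,2) weld q_lip]) (use e0 eps in auto)
  have ReL: "\<bar>Re (L z)\<bar> \<le> \<epsilon>" if z: "cmod z = 1" for z
  proof -
    obtain w where w: "cmod w = 1" "w * exp (q w) = z * exp (cnj (L z))" using weld[OF z] by blast
    have "exp (Re (q w)) = exp (Re (L z))"
      using arg_cong[OF w(2), of cmod] w(1) z by (simp add: norm_mult norm_exp_eq_Re)
    then show ?thesis using abs_Re_le_cmod[of "q w"] q_le[OF w(1)] by simp
  qed
  \<comment> \<open>Cutoff 1, real part at most \<epsilon> and seminorm constant 4 \<epsilon> give
    (1 + 3 + 4) \<epsilon>.\<close>
  have L_le: "cmod (L z) \<le> 8 * \<epsilon>" if "z \<in> cball 0 1" for z
    using sup_bound_from_real_part[OF L(1) La L(3) ReL _ Dirichlet_seminorm_le[OF L(1) La DL] _ that, of 1] e0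
    by simp
  then show "z \<in> cball 0 1 \<Longrightarrow> cmod (L z) \<le> 8 * \<epsilon>" .
  define E where "E z = L z + of_real t * P z" for z
  define c where "c n = a n + of_real t * b n" for n
  have cE: "continuous_on (cball 0 1) E" unfolding E_def by (intro continuous_intros L P)
  have Ec: "(\<lambda>n. c n * z ^ n) sums E z" if "z \<in> ball 0 1" for z
    using sums_add[OF La[OF that] sums_mult[OF Pb[OF that], of "of_real t"]]
    by (simp add: c_def E_def algebra_simps)
  have ImE: "Im (E 0) = 0" using L(3) P(3) by (simp add: E_def)
  have ReE: "\<bar>Re (E z)\<bar> \<le> \<delta> + 27 * t * M * \<epsilon>" if z: "cmod z = 1" for z
  proof -
    obtain w where w: "cmod w = 1" "w * exp (q w) = z * exp (cnj (L z))" using weld[OF z] by blast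
    have eq: "Re (q w) = Re (L z)"
      using arg_cong[OF w(2), of cmod] w(1) z by (simp add: norm_mult norm_exp_eq_Re)
    \<comment> \<open>The asymptotics of \<open>q\<close> are known at \<open>w\<close> but needed
      at \<open>z\<close>. The exponent is at most (8 + 1) \<epsilon>, so the points differ by at
      most 27 \<epsilon>, and the Lipschitz bound on \<open>P\<close> transfers the
      estimate.\<close>
    have "w = z * exp (cnj (L z) - q w)" using w(2) by (simp add: exp_diff field_simps)
    then have "w - z = z * (exp (cnj (L z) - q w) - 1)" by (simp add: algebra_simps)
    then have "cmod (w - z) = cmod (exp (cnj (L z) - q w) - 1)" using z by (metis mult_1 norm_mult)
    also have "\<dots> \<le> 3 * cmod (cnj (L z) - q w)"
      using norm_triangle_ineq4[of "cnj (L z)" "q w"] L_le[of z] q_le[OF w(1)] z eps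
      by (intro norm_exp_minus_one_le) simp
    also have "\<dots> \<le> 27 * \<epsilon>"
      using norm_triangle_ineq4[of "cnj (L z)" "q w"] L_le[of z] q_le[OF w(1)] z by simp
    finally have wz: "cmod (z - w) \<le> 27 * \<epsilon>" by (simp add: norm_minus_commute)
    have "Re (E z) = Re (q w + of_real t * P w) + t * Re (P z - P w)"
      using eq by (simp add: E_def algebra_simps)
    also have "\<bar>\<dots>\<bar> \<le> \<bar>Re (q w + of_real t * P w)\<bar> + t * \<bar>Re (P z - P w)\<bar>"
      using t by (metis abs_mult abs_of_nonneg abs_triangle_ineq)
    also have "\<dots> \<le> \<delta> + t * (M * (27 * \<epsilon>))"
    proof (intro add_mono mult_left_mono t)
      show "\<bar>Re (q w + of_real t * P w)\<bar> \<le> \<delta>" using abs_Re_le_cmod q_asym[OF w(1)] order_trans by blast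
      have "\<bar>Re (P z - P w)\<bar> \<le> M * cmod (z - w)"
        using abs_Re_le_cmod[of "P z - P w"] P_lip[of z w] z w by simp
      also have "\<dots> \<le> M * (27 * \<epsilon>)" using wz M0 by (rule mult_left_mono)
      finally show "\<bar>Re (P z - P w)\<bar> \<le> M * (27 * \<epsilon>)" .
    qed
    finally show ?thesis by (simp add: mult_ac)
  qed
  \<comment> \<open>By \<open>(x + y)\<^sup>2 \<le> 2 * x\<^sup>2 + 2 * y\<^sup>2\<close>, the
    squared seminorm is at most \<open>32 * \<epsilon>\<^sup>2\<close> from \<open>L\<close> plus
    \<open>2 * (t * M)\<^sup>2\<close> from \<open>t P\<close>; the square of \<open>K\<close>
    dominates the sum.\<close>
  define K where "K = 6 * \<epsilon> + 2 * t * M"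
  have K0: "K \<ge> 0" using e0 t M0 by (simp add: K_def)
  have "\<forall>\<^sub>F h in at_right 0.
      integral {0..2*pi} (\<lambda>x. (cmod (E (cis h * cis x) - E (cis x)))\<^sup>2) \<le> 2 * pi * K\<^sup>2 * h\<^sup>2"
    using DL
  proof eventually_elim
    case (elim h)
    have int: "(\<lambda>x. (cmod (G (cis h * cis x) - G (cis x)))\<^sup>2) integrable_on {0..2*pi}"
      if "continuous_on (cball 0 1) G" for G
      by (intro integrable_continuous_interval continuous_intros continuous_on_circle_rotate continuous_on_circle that)
    have "integral {0..2*pi} (\<lambda>x. (cmod (E (cis h * cis x) - E (cis x)))\<^sup>2) \<le>
      integral {0..2*pi} (\<lambda>x. 2 * (cmod (L (cis h * cis x) - L (cis x)))\<^sup>2 + 2 * (t * (M * h))\<^sup>2)"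
    proof (intro integral_le int cE)
      show "(\<lambda>x. 2 * (cmod (L (cis h * cis x) - L (cis x)))\<^sup>2 + 2 * (t * (M * h))\<^sup>2) integrable_on {0..2*pi}"
        by (intro integrable_add integrable_on_mult_right int L integrable_on_const) auto
      fix x
      have "cmod (P (cis h * cis x) - P (cis x)) \<le> M * cmod (cis h * cis x - cis x)"
        by (rule P_lip) (auto simp: norm_mult)
      also have "\<dots> \<le> M * \<bar>h\<bar>"
        using norm_cis_diff_le[of "h + x" x] M0 by (intro mult_left_mono) (auto simp: cis_mult)
      finally have 1: "cmod (of_real t * (P (cis h * cis x) - P (cis x))) \<le> t * (M * \<bar>h\<bar>)"
        using t by (simp add: norm_mult mult_left_mono)
      have "(cmod (E (cis h * cis x) - E (cis x)))\<^sup>2 = (cmod ((L (cis h * cis x) - L (cis x)) + of_real t * (P (cis h * cis x) - P (cis x))))\<^sup>2"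
        by (simp add: E_def algebra_simps)
      also have "\<dots> \<le> (cmod (L (cis h * cis x) - L (cis x)) + t * (M * \<bar>h\<bar>))\<^sup>2"
        using 1 by (intro power_mono norm_triangle_le) auto
      also have "\<dots> \<le> 2 * (cmod (L (cis h * cis x) - L (cis x)))\<^sup>2 + 2 * (t * (M * \<bar>h\<bar>))\<^sup>2"
        using sum_squares_bound[of "cmod (L (cis h * cis x) - L (cis x))" "t * (M * \<bar>h\<bar>)"] by (simp add: power2_sum)
      finally show "(cmod (E (cis h * cis x) - E (cis x)))\<^sup>2 \<le> 2 * (cmod (L (cis h * cis x) - L (cis x)))\<^sup>2 + 2 * (t * (M * h))\<^sup>2"
        by (simp add: power_mult_distrib)
    qed
    also have "\<dots> = 2 * integral {0..2*pi} (\<lambda>x. (cmod (L (cis h * cis x) - L (cis x)))\<^sup>2) + 2 * pi * (2 * (t * (M * h))\<^sup>2)"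
      by (subst integral_add) (auto intro!: integrable_on_mult_right int L)
    also have "\<dots> \<le> 2 * (2 * pi * (4 * \<epsilon>)\<^sup>2 * h\<^sup>2) + 2 * pi * (2 * (t * (M * h))\<^sup>2)"
      using elim by simp
    also have "\<dots> = 2 * pi * (32 * \<epsilon>\<^sup>2 + 2 * (t * M)\<^sup>2) * h\<^sup>2"
      by (simp add: power_mult_distrib algebra_simps)
    also have "\<dots> \<le> 2 * pi * K\<^sup>2 * h\<^sup>2"
    proof (intro mult_right_mono mult_left_mono)
      have "K\<^sup>2 = 36 * \<epsilon>\<^sup>2 + 4 * (t * M)\<^sup>2 + 24 * (\<epsilon> * (t * M))"
        by (simp add: K_def power2_eq_square algebra_simps)
      moreover have "\<epsilon> * (t * M) \<ge> 0" using e0 t M0 by simp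
      moreover have "\<epsilon>\<^sup>2 \<ge> 0" "(t * M)\<^sup>2 \<ge> 0" by auto
      ultimately show "32 * \<epsilon>\<^sup>2 + 2 * (t * M)\<^sup>2 \<le> K\<^sup>2" by linarith
    qed auto
    finally show ?case .
  qed
  from sup_bound_from_real_part[OF cE Ec ImE ReE K0 Dirichlet_seminorm_le[OF cE Ec this] N]
  have "cmod (E z) \<le> (\<delta> + 27 * t * M * \<epsilon>) + 3 * sqrt N * (\<delta> + 27 * t * M * \<epsilon>) + K / sqrt N" if "z \<in> cball 0 1" for z
    using that by blast
  then show "z \<in> cball 0 1 \<Longrightarrow> cmod (L z + of_real t * P z) \<le> (1 + 3 * sqrt N) * (\<delta> + 27 * t * M * \<epsilon>) + (6 * \<epsilon> + 2 * t * M) / sqrt N"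
    by (simp add: E_def K_def algebra_simps)
qed

lemma Lipschitz_on_cball_if_on_ball:
  fixes g :: "complex \<Rightarrow> complex"
  assumes cont: "continuous_on (cball 0 1) g"
    and lip: "\<And>x y. x \<in> ball 0 1 \<Longrightarrow> y \<in> ball 0 1 \<Longrightarrow> cmod (g x - g y) \<le> B * cmod (x - y)"
    and xy: "x \<in> cball 0 1" "y \<in> cball 0 1"
  shows "cmod (g x - g y) \<le> B * cmod (x - y)"
proof -
  define S :: "(complex \<times> complex) set" where "S = ball 0 1 \<times> ball 0 1"
  have cl: "closure S = cball 0 1 \<times> cball 0 1" by (simp add: S_def closure_Times)
  have "(\<lambda>w. cmod (g (fst w) - g (snd w)) - B * cmod (fst w - snd w)) (x, y) \<le> 0"
  proof (rule continuous_le_on_closure[of S])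
    show "continuous_on (closure S) (\<lambda>w. cmod (g (fst w) - g (snd w)) - B * cmod (fst w - snd w))"
      unfolding cl by (intro continuous_intros continuous_on_compose2[OF cont]) auto
    show "(x, y) \<in> closure S" using xy by (simp add: cl)
  qed (use lip in \<open>auto simp: S_def\<close>)
  then show ?thesis by simp
qed

text \<open>The common Lipschitz constant upgrades pointwise continuity in time to joint continuity,
  and compactness makes it uniform in \<open>z\<close>. The interval up to T/2 is a compact part of
  the half-open time range.\<close>

lemma equi_Lipschitz_uniform_limit:
  fixes p :: "complex \<Rightarrow> real \<Rightarrow> complex"
  assumes lip: "\<And>t x y. t \<in> {0..<T} \<Longrightarrow> x \<in> cball 0 1 \<Longrightarrow> y \<in> cball 0 1 \<Longrightarrow> cmod (p x t - p y t) \<le> M * cmod (x - y)"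
    and cont: "\<And>z. z \<in> cball 0 1 \<Longrightarrow> continuous_on {0..<T} (p z)"
    and "0 < T" "0 < e"
  shows "\<forall>\<^sub>F t in at_right 0. \<forall>z\<in>cball 0 1. \<forall>s. 0 < s \<and> s < t \<longrightarrow> cmod (p z s - p z 0) \<le> e"
proof -
  have sub: "{0..T/2} \<subseteq> {0..<T}" using \<open>0 < T\<close> by auto
  have "continuous_on (cball 0 1 \<times> {0..T/2}) (\<lambda>(z, t). p z t)"
    by (rule continuous_on_Times_Lipschitz[where K = M])
       (use lip sub continuous_on_subset[OF cont sub] in \<open>auto simp: dist_norm\<close>)
  then have "uniformly_continuous_on (cball 0 1 \<times> {0..T/2}) (\<lambda>(z, t). p z t)"
    by (intro compact_uniformly_continuous compact_Times) auto
  then obtain d where d: "d > 0" "\<And>x y. x \<in> cball 0 1 \<times> {0..T/2} \<Longrightarrow> y \<in> cball 0 1 \<times> {0..T/2} \<Longrightarrow> dist y x < d \<Longrightarrow>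
      dist (case y of (z, t) \<Rightarrow> p z t) (case x of (z, t) \<Rightarrow> p z t) < e"
    unfolding uniformly_continuous_on_def using \<open>0 < e\<close> by metis
  have "\<forall>\<^sub>F t in at_right 0. 0 < t \<and> t < min d (T/2)"
    unfolding eventually_at_right_field using d(1) \<open>0 < T\<close> by (intro exI[of _ "min d (T/2)"]) simp
  then show ?thesis
  proof eventually_elim
    case (elim t)
    show ?case
    proof (intro ballI allI impI)
      fix z :: complex and s :: real assume "z \<in> cball 0 1" "0 < s \<and> s < t"
      then show "cmod (p z s - p z 0) \<le> e"
        using d(2)[of "(z, 0)" "(z, s)"] elim by (simp add: dist_Pair_Pair dist_norm)
    qed
  qed
qed

text \<open>Comparing with the point 0 shows that \<open>f z / z\<close> is within \<open>b\<close>
  of 1 on the circle, so the principal logarithm is defined, Lipschitz and linear up to a quadratic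
  error there.\<close>

lemma boundary_logarithm:
  fixes f P :: "complex \<Rightarrow> complex"
  assumes f0: "f 0 = 0" and b: "b \<le> 1/4"
    and lip: "\<And>x y. x \<in> cball 0 1 \<Longrightarrow> y \<in> cball 0 1 \<Longrightarrow> cmod ((f x - x) - (f y - y)) \<le> b * cmod (x - y)"
    and asym: "\<And>z. cmod z = 1 \<Longrightarrow> cmod (f z - z + of_real t * (z * P z)) \<le> \<delta>"
  defines "q \<equiv> \<lambda>z. Ln (f z / z)"
  shows "cmod w = 1 \<Longrightarrow> w * exp (q w) = f w"
    and "cmod w = 1 \<Longrightarrow> cmod w' = 1 \<Longrightarrow> cmod (q w' - q w) \<le> 4 * b * cmod (w' - w)"
    and "cmod w = 1 \<Longrightarrow> cmod (q w) \<le> 4 * b"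
    and "cmod w = 1 \<Longrightarrow> cmod (q w + of_real t * P w) \<le> 2 * b\<^sup>2 + \<delta>"
proof -
  have u: "cmod (f z - z) \<le> b" if "cmod z = 1" for z
    using lip[of z 0] that f0 by simp
  have b0: "b \<ge> 0" using u[of 1] norm_ge_zero[of "f 1 - 1"] by (simp del: norm_ge_zero)
  have d: "f z / z = 1 + (f z - z) / z" "cmod ((f z - z) / z) \<le> b" if "cmod z = 1" for z
  proof -
    have "z \<noteq> 0" using that by auto
    then show "f z / z = 1 + (f z - z) / z" by (simp add: field_simps)
    show "cmod ((f z - z) / z) \<le> b" using u[OF that] that by (simp add: norm_divide)
  qed
  have near: "cmod (f z / z - 1) \<le> 1/2" if "cmod z = 1" for z
    using d[OF that] b by simp
  show "w * exp (q w) = f w" if "cmod w = 1"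
  proof -
    have "f w / w \<noteq> 0" using near[OF that] by auto
    then show ?thesis by (auto simp: q_def)
  qed
  show "cmod (q w' - q w) \<le> 4 * b * cmod (w' - w)" if w: "cmod w = 1" "cmod w' = 1"
  proof -
    have nz: "w \<noteq> 0" "w' \<noteq> 0" using w by auto
    \<comment> \<open>Splits the increment into that of \<open>f - z\<close> and that of
      \<open>1/z\<close>; each contributes \<open>b\<close>, and the logarithm doubles the
      sum.\<close>
    have "f w' / w' - f w / w = ((f w' - w') - (f w - w)) / w' + (f w - w) / w * ((w - w') / w')"
      using nz by (simp add: field_simps)
    also have "cmod \<dots> \<le> cmod (((f w' - w') - (f w - w)) / w') + cmod ((f w - w) / w * ((w - w') / w'))"
      by (rule norm_triangle_ineq)
    also have "\<dots> = cmod ((f w' - w') - (f w - w)) + cmod (f w - w) * cmod (w' - w)"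
      using w by (simp add: norm_mult norm_divide norm_minus_commute[of w w'])
    also have "\<dots> \<le> b * cmod (w' - w) + b * cmod (w' - w)"
      using w u[of w] by (intro add_mono lip mult_right_mono) auto
    finally have "cmod (f w' / w' - f w / w) \<le> 2 * b * cmod (w' - w)" by simp
    moreover have "cmod (q w' - q w) \<le> 2 * cmod (f w' / w' - f w / w)"
      unfolding q_def by (rule Ln_Lipschitz_near_1[OF near[OF w(2)] near[OF w(1)]])
    ultimately show ?thesis by simp
  qed
  show "cmod (q w) \<le> 4 * b" if w: "cmod w = 1"
  proof -
    have "cmod (q w) \<le> 2 * cmod ((f w - w) / w)"
      unfolding q_def d(1)[OF w] using d(2)[OF w] b by (intro norm_Ln_le) simp
    then show ?thesis using d(2)[OF w] b0 by linarith
  qed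
  show "cmod (q w + of_real t * P w) \<le> 2 * b\<^sup>2 + \<delta>" if w: "cmod w = 1"
  proof -
    define x where "x = (f w - w) / w"
    have nz: "w \<noteq> 0" using w by auto
    have xb: "cmod x \<le> b" using d(2)[OF w] by (simp add: x_def)
    have "cmod (q w - x) \<le> (cmod x)\<^sup>2 / (1 - cmod x)"
      unfolding q_def d(1)[OF w] x_def[symmetric] using xb b by (intro Ln_approx_linear) simp
    also have "\<dots> \<le> b\<^sup>2 / (1/2)" using xb b by (intro frac_le power_mono) auto
    finally have 1: "cmod (q w - x) \<le> 2 * b\<^sup>2" by simp
    have "x + of_real t * P w = (f w - w + of_real t * (w * P w)) / w"
      using nz by (simp add: x_def field_simps)
    then have "cmod (x + of_real t * P w) \<le> \<delta>" using asym[OF w] w by (simp add: norm_divide)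
    then show ?thesis using 1 norm_triangle_ineq[of "q w - x" "x + of_real t * P w"] by simp
  qed
qed

text \<open>Exponents agree modulo 2 pi i; the three smallness assumptions keep the discrepancy at
  most 3, below 2 pi, which fixes the branch.\<close>

lemma welding_argument:
  fixes l q :: complex and \<psi> \<theta> :: real
  assumes eq: "cis \<psi> * exp q = cis \<theta> * exp (cnj l)"
    and small: "\<bar>\<psi> - \<theta>\<bar> \<le> 1" "cmod q \<le> 1" "cmod l \<le> 1"
  shows "\<psi> - \<theta> = Im (cnj l - q)"
proof -
  have "exp (\<i> * of_real \<psi> + q) = exp (\<i> * of_real \<theta> + cnj l)"
    using eq by (simp add: cis_conv_exp exp_add)
  then obtain n :: int where n: "\<i> * of_real \<psi> + q = \<i> * of_real \<theta> + cnj l + (of_int (2 * n) * pi) * \<i>"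
    unfolding exp_eq by blast
  have im: "\<psi> + Im q = \<theta> - Im l + 2 * pi * n" using arg_cong[OF n, of Im] by (simp add: algebra_simps)
  then have "\<bar>2 * pi * n\<bar> \<le> 3"
    using small abs_Im_le_cmod[of q] abs_Im_le_cmod[of l] by linarith
  then have "\<bar>2 * pi * n\<bar> < 2 * pi * 1" using pi_gt3 by linarith
  then have "\<bar>real_of_int n\<bar> < 1" by (simp add: abs_mult)
  then have "n = 0" by linarith
  then show ?thesis using im by simp
qed

section \<open>Choice of parameters and passage to the limit\<close>

theorem theorem1:
  fixes p f :: "complex \<Rightarrow> real \<Rightarrow> complex"
    and F :: "real \<Rightarrow> complex \<Rightarrow> complex"
    and T :: real
  assumes T_pos: "T > 0"
    and carath: "\<forall>t\<in>{0..<T}. caratheodory (\<lambda>z. p z t)"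
    and p_C2: "\<forall>t\<in>{0..<T}. C2_closed_disc (\<lambda>z. p z t)"
    and p_cont_t: "\<forall>z\<in>cball 0 1. continuous_on {0..<T} (p z)"
    and p_bdd: "\<exists>M. \<forall>t\<in>{0..<T}. (\<forall>z\<in>cball 0 1. norm (p z t) \<le> M) \<and>
                 (\<forall>z\<in>ball 0 1. norm (deriv (\<lambda>w. p w t) z) \<le> M \<and>
                                 norm (deriv (deriv (\<lambda>w. p w t)) z) \<le> M)"
    and f_conf: "\<forall>t\<in>{0..<T}. (\<lambda>z. f z t) holomorphic_on ball 0 1 \<and>
                   inj_on (\<lambda>z. f z t) (ball 0 1) \<and>
                   (\<lambda>z. f z t) ` ball 0 1 \<subseteq> ball 0 1 \<and>
                   f 0 t = 0 \<and> deriv (\<lambda>z. f z t) 0 = of_real (exp (- t))"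
    and LK: "\<forall>z\<in>ball 0 1. \<forall>t\<in>{0..<T}.
               ((\<lambda>s. f z s) has_vector_derivative (- z * deriv (\<lambda>w. f w t) z * p z t))
                 (at t within {0..<T})"
    and f_init: "\<forall>z\<in>ball 0 1. f z 0 = z"
    and f_boundary: "\<forall>t\<in>{0..<T}. continuous_on (cball 0 1) (\<lambda>z. f z t)"
    and F_conf: "\<forall>t\<in>{0..<T}. F t holomorphic_on {z. 1 < norm z} \<and>
                   inj_on (F t) {z. 1 < norm z} \<and>
                   F t ` {z. 1 < norm z} = outside (frontier ((\<lambda>z. f z t) ` ball 0 1)) \<and>
                   (\<exists>c>0. ((\<lambda>z. F t z / z) \<longlongrightarrow> of_real c) at_infinity) \<and>
                   continuous_on {z. 1 \<le> norm z} (F t)"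
  shows "\<forall>\<theta> \<psi>. (\<forall>\<^sub>F t in at_right 0. f (cis (\<psi> t)) t = F t (cis \<theta>)) \<and>
                (\<psi> \<longlongrightarrow> \<theta>) (at_right 0) \<longrightarrow>
           ((\<lambda>t. (\<psi> t - \<theta> - 2 * Im (p (cis \<theta>) 0) * t) / t) \<longlongrightarrow> 0) (at_right 0)"
proof (intro allI impI, elim conjE)
  fix \<theta> :: real and \<psi> :: "real \<Rightarrow> real"
  assume weld: "\<forall>\<^sub>F t in at_right 0. f (cis (\<psi> t)) t = F t (cis \<theta>)"
    and \<psi>: "(\<psi> \<longlongrightarrow> \<theta>) (at_right 0)"
  obtain M where M: "\<And>t z. t \<in> {0..<T} \<Longrightarrow> z \<in> cball 0 1 \<Longrightarrow> cmod (p z t) \<le> M"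
    "\<And>t z. t \<in> {0..<T} \<Longrightarrow> z \<in> ball 0 1 \<Longrightarrow> cmod (deriv (\<lambda>w. p w t) z) \<le> M"
    using p_bdd by blast
  have p_hol: "(\<lambda>z. p z t) holomorphic_on ball 0 1" and p_0: "p 0 t = 1"
    and p_Re: "\<And>z. z \<in> ball 0 1 \<Longrightarrow> Re (p z t) > 0" if "t \<in> {0..<T}" for t
    using carath that by (auto simp: caratheodory_def)
  have p_cont: "continuous_on (cball 0 1) (\<lambda>z. p z t)" if "t \<in> {0..<T}" for t
    using p_C2 that by (auto simp: C2_closed_disc_def)
  \<comment> \<open>The normalization \<open>p 0 0 = 1\<close> forces this, so \<open>M\<close> may
    be divided by.\<close>
  have "M \<ge> 1" using M(1)[of 0 0] p_0[of 0] T_pos by simp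
  then have M0: "M > 0" by simp
  have p_lip: "cmod (p x t - p y t) \<le> M * cmod (x - y)"
    if "t \<in> {0..<T}" "x \<in> cball 0 1" "y \<in> cball 0 1" for t x y
    by (rule Lipschitz_on_cball_if_on_ball[where g = "\<lambda>z. p z t", OF p_cont[OF that(1)] deriv_bound_imp_Lipschitz[OF p_hol[OF that(1)] M(2)[OF that(1)]] that(2,3)])
  have f_hol: "(\<lambda>z. f z t) holomorphic_on ball 0 1" and f_inj: "inj_on (\<lambda>z. f z t) (ball 0 1)"
    and f_ball: "(\<lambda>z. f z t) ` ball 0 1 \<subseteq> ball 0 1" and f_0: "f 0 t = 0"
    and f_cont: "continuous_on (cball 0 1) (\<lambda>z. f z t)" if "t \<in> {0..<T}" for t
    using f_conf f_boundary that by auto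
  have f_le: "cmod (f z t) \<le> 1" if "t \<in> {0..<T}" "z \<in> ball 0 1" for t z
    using f_ball[OF that(1)] that(2) by (auto simp: image_subset_iff less_imp_le)
  have LK': "((\<lambda>s. f z s) has_vector_derivative (- z * deriv (\<lambda>w. f w t) z * p z t)) (at t within {0..<T})"
    if "t \<in> {0..<T}" "z \<in> ball 0 1" for t z
    using LK that by blast
  have lip_ball: "cmod ((f x t - x) - (f y t - y)) \<le> 6 * M * t * cmod (x - y)"
    if "0 < t" "t < T" "8 * M * t \<le> 1" "x \<in> ball 0 1" "y \<in> ball 0 1" for t x y
    by (rule Loewner_Kufarev_displacement_Lipschitz[OF p_hol p_Re M(1) M(2) f_hol f_le LK' _ that(1,2,3,4,5)])
       (use f_init in auto)
  show "((\<lambda>t. (\<psi> t - \<theta> - 2 * Im (p (cis \<theta>) 0) * t) / t) \<longlongrightarrow> 0) (at_right 0)"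
  proof (rule tendstoI)
    fix \<eta> :: real assume \<eta>: "\<eta> > 0"
    \<comment> \<open>With \<epsilon> = 24 M t below, the seminorm constant
      \<open>6 * \<epsilon> + 2 * t * M\<close> is 146 M t; \<open>N\<close> makes the
      high-frequency part at most \<eta> t / 4, whence 584 = 4 * 146.\<close>
    define N where "N = nat \<lceil>(584 * M / \<eta>)\<^sup>2\<rceil> + 1"
    have N1: "N \<ge> 1" by (simp add: N_def)
    have "(584 * M / \<eta>)\<^sup>2 \<le> real N" unfolding N_def by linarith
    then have "584 * M / \<eta> \<le> sqrt N" by (rule real_le_rsqrt)
    then have N: "146 * M / sqrt N \<le> \<eta> / 4" using N1 \<eta> by (simp add: field_simps)
    \<comment> \<open>Chosen after \<open>N\<close>: real-part errors of size 2 e t enter with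
      factor \<open>1 + 3 * sqrt N\<close> through \<open>L\<close> and once more through
      \<open>q\<close>, and together they should cost \<eta> t / 4.\<close>
    define e where "e = \<eta> / (8 * (2 + 3 * sqrt N))"
    have sN: "2 + 3 * sqrt N > 0" by (simp add: add_pos_nonneg)
    have e: "e > 0" "2 * e * (2 + 3 * sqrt N) = \<eta> / 4" using \<eta> sN by (simp_all add: e_def del: distrib_left_numeral)
    \<comment> \<open>The bound 1 / (384 M) makes \<epsilon> = 24 M t at most 1/16. The bound with
      726 collects the quadratic errors 72 + 6 + 648, in units of
      \<open>M\<^sup>2 * t\<^sup>2\<close>.\<close>
    have small: "\<forall>\<^sub>F t in at_right 0. 0 < t \<and> t < min T (min (1 / (384 * M)) (e / (726 * M\<^sup>2)))"
      unfolding eventually_at_right_field using T_pos M0 e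
      by (intro exI[of _ "min T (min (1 / (384 * M)) (e / (726 * M\<^sup>2)))"]) simp
    have near: "\<forall>\<^sub>F t in at_right 0. \<forall>z\<in>cball 0 1. \<forall>s. 0 < s \<and> s < t \<longrightarrow> cmod (p z s - p z 0) \<le> e"
      by (rule equi_Lipschitz_uniform_limit[OF p_lip _ T_pos e(1)]) (use p_cont_t in auto)
    have \<psi>_near: "\<forall>\<^sub>F t in at_right 0. dist (\<psi> t) \<theta> < min 1 (\<eta> / (4 * M))"
      by (rule tendstoD[OF \<psi>]) (use \<eta> M0 in simp)
    show "\<forall>\<^sub>F t in at_right 0. dist ((\<psi> t - \<theta> - 2 * Im (p (cis \<theta>) 0) * t) / t) 0 < \<eta>"
      using weld small near \<psi>_near
    proof eventually_elim
      case (elim t)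
      then have t: "0 < t" "t < T" "384 * M * t \<le> 1" "726 * M\<^sup>2 * t \<le> e"
        using M0 by (auto simp: field_simps)
      have tT: "t \<in> {0..<T}" and zT: "0 \<in> {0..<T}" using t T_pos by auto
      have Mt: "0 < M * t" "M * t \<le> 1 / 384" using t M0 by auto
      \<comment> \<open>\<open>b\<close> is the Lipschitz constant of \<open>f - z\<close>, and
        \<epsilon> that of its logarithmic form \<open>q\<close>.\<close>
      define b where "b = 6 * M * t"
      define \<epsilon> where "\<epsilon> = 4 * b"
      have lip: "cmod ((f x t - x) - (f y t - y)) \<le> b * cmod (x - y)"
        if "x \<in> cball 0 1" "y \<in> cball 0 1" for x y
      proof (rule Lipschitz_on_cball_if_on_ball[where g = "\<lambda>z. f z t - z", OF _ _ that])
        show "continuous_on (cball 0 1) (\<lambda>z. f z t - z)" by (intro continuous_intros f_cont tT)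
        show "cmod ((f x t - x) - (f y t - y)) \<le> b * cmod (x - y)" if "x \<in> ball 0 1" "y \<in> ball 0 1" for x y
          unfolding b_def using t Mt that by (intro lip_ball) auto
      qed
      have first: "cmod (f z t - z + of_real t * (z * p z 0)) \<le> t * (e + b * M)" if "z \<in> ball 0 1" for z
      proof (rule Loewner_Kufarev_first_order[where p = p and T = T, OF _ f_hol LK' _ _ t(1,2) _ that])
        fix s w w' assume s: "0 < s" "s < t" and w: "w \<in> ball (0::complex) 1" "w' \<in> ball (0::complex) 1"
        have "M * s \<le> M * t" using s M0 by simp
        then have "8 * M * s \<le> 1" "6 * M * s \<le> b" using Mt by (auto simp: b_def)
        moreover from this have "cmod ((f w s - w) - (f w' s - w')) \<le> 6 * M * s * cmod (w - w')"
          using s t w by (intro lip_ball) auto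
        ultimately show "cmod ((f w s - w) - (f w' s - w')) \<le> b * cmod (w - w')"
          by (meson mult_right_mono norm_ge_zero order_trans)
      qed (use M(1) f_init elim(3) that in auto)
      have asym: "cmod (f z t - z + of_real t * (z * p z 0)) \<le> t * (e + b * M)" if "cmod z = 1" for z
      proof (rule continuous_on_closure_norm_le[of "ball 0 1" "\<lambda>z. f z t - z + of_real t * (z * p z 0)"])
        show "continuous_on (closure (ball 0 1)) (\<lambda>z. f z t - z + of_real t * (z * p z 0))"
          using f_cont[OF tT] p_cont[OF zT] by (auto intro!: continuous_intros)
      qed (use first that in auto)
      define P where "P z = p z 0" for z
      define q where "q z = Ln (f z t / z)" for z
      have "b \<le> 1/4" using Mt by (simp add: b_def)
      note bl = boundary_logarithm[where f = "\<lambda>z. f z t" and P = "\<lambda>z. p z 0" and t = t, OF f_0[OF tT] this lip asym,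
          folded q_def \<epsilon>_def]
      have tot: "2 * b\<^sup>2 + t * (e + b * M) + 27 * t * M * \<epsilon> \<le> 2 * e * t"
      proof -
        have "2 * b\<^sup>2 + t * (e + b * M) + 27 * t * M * \<epsilon> = t * (e + 726 * M\<^sup>2 * t)"
          by (simp add: b_def \<epsilon>_def power2_eq_square algebra_simps)
        also have "\<dots> \<le> t * (e + e)" using t by (intro mult_left_mono) auto
        finally show ?thesis by (simp add: mult.commute)
      qed
      define \<Gamma> where "\<Gamma> = frontier ((\<lambda>z. f z t) ` ball 0 1)"
      have Fc: "F t holomorphic_on {z. 1 < norm z}" "inj_on (F t) {z. 1 < norm z}"
        "F t ` {z. 1 < norm z} = outside \<Gamma>" "continuous_on {z. 1 \<le> norm z} (F t)"
        "\<exists>c>0. ((\<lambda>z. F t z / z) \<longlongrightarrow> of_real c) at_infinity"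
        using F_conf tT by (auto simp: \<Gamma>_def)
      have F\<Gamma>: "F t z \<in> \<Gamma>" if "cmod z = 1" for z
        by (rule exterior_map_boundary[OF Fc(1-4) _ that]) (simp add: \<Gamma>_def)
      have \<Gamma>f: "\<Gamma> \<subseteq> (\<lambda>z. f z t) ` sphere 0 1"
        unfolding \<Gamma>_def by (rule frontier_image_ball_subset[OF f_cont f_hol f_inj]) (use tT in auto)
      define \<Omega> where "\<Omega> = (\<lambda>z. f z t) ` ball 0 1"
      have "0 \<in> \<Omega>" unfolding \<Omega>_def using f_0[OF tT] by force
      moreover have "open \<Omega>"
        unfolding \<Omega>_def by (rule open_mapping_thm3[OF f_hol[OF tT] open_ball f_inj[OF tT]])
      moreover have "bounded \<Omega>"
        unfolding \<Omega>_def using f_ball[OF tT] bounded_ball bounded_subset by blast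
      moreover have "\<Gamma> = frontier \<Omega>" by (simp add: \<Gamma>_def \<Omega>_def)
      \<comment> \<open>The origin is interior to the bounded domain, so it lies neither on \<Gamma>
        nor outside it; hence \<open>F t\<close> omits 0 and has the required logarithm.\<close>
      ultimately have out: "0 \<notin> outside \<Gamma>" "0 \<notin> \<Gamma>"
        using outside_frontier_misses_closure[of \<Omega>] closure_subset[of \<Omega>]
        by (auto simp: frontier_def interior_open)
      have F_nz: "F t z \<noteq> 0" if "1 \<le> cmod z" for z
      proof (cases "cmod z = 1")
        case True
        then show ?thesis using F\<Gamma> out(2) by metis
      next
        case False
        then have "F t z \<in> outside \<Gamma>" using that Fc(3) by force
        then show ?thesis using out(1) by metis
      qed
      obtain c where "c > 0" "((\<lambda>z. F t z / z) \<longlongrightarrow> of_real c) at_infinity" using Fc(5) by blast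
      from exterior_map_logarithm[OF Fc(1,4) F_nz this]
      obtain L where L: "continuous_on (cball 0 1) L" "L holomorphic_on ball 0 1" "Im (L 0) = 0"
        "\<And>z. cmod z = 1 \<Longrightarrow> F t z = z * exp (cnj (L z))" by blast
      \<comment> \<open>\<open>F t\<close> sends the circle into \<Gamma>, and every point of
        \<Gamma> is a value of \<open>f\<close> on the circle.\<close>
      have ex: "\<exists>w. cmod w = 1 \<and> w * exp (q w) = z * exp (cnj (L z))" if z: "cmod z = 1" for z
      proof -
        obtain w where "cmod w = 1" "F t z = f w t" using F\<Gamma>[OF z] \<Gamma>f by auto
        then show ?thesis using bl(1)[of w] L(4)[OF z] by auto
      qed
      have eps: "\<epsilon> \<le> 1/16" using Mt by (simp add: \<epsilon>_def b_def)
      have q_lip: "cmod (q w' - q w) \<le> \<epsilon> * cmod (w' - w)" if "cmod w = 1" "cmod w' = 1" for w w'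
        using bl(2) that by blast
      have q_le: "cmod (q w) \<le> \<epsilon>" and q_asym: "cmod (q w + of_real t * P w) \<le> 2 * b\<^sup>2 + t * (e + b * M)"
        if "cmod w = 1" for w
        using bl(3,4) that by (auto simp: P_def)
      have P: "continuous_on (cball 0 1) P" "P holomorphic_on ball 0 1" "Im (P 0) = 0"
        using p_cont[OF zT] p_hol[OF zT] p_0[OF zT] by (simp_all add: P_def[abs_def])
      have P_lip: "cmod (P x - P y) \<le> M * cmod (x - y)" if "x \<in> cball 0 1" "y \<in> cball 0 1" for x y
        unfolding P_def by (rule p_lip[OF zT that])
      have t_nonneg: "0 \<le> t" and cis_in: "cis \<theta> \<in> cball 0 1" using t by auto
      have wa1: "cmod (L (cis \<theta>)) \<le> 8 * \<epsilon>"
        by (rule welding_asymptotics(1)[where q = q and \<epsilon> = \<epsilon> and P = P and M = M and t = t and \<delta> = "2 * b\<^sup>2 + t * (e + b * M)" and N = N];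
            fact L(1-3) ex q_lip q_le eps P P_lip t_nonneg q_asym N1 cis_in)
      have wa2: "cmod (L (cis \<theta>) + of_real t * P (cis \<theta>)) \<le>
          (1 + 3 * sqrt N) * (2 * b\<^sup>2 + t * (e + b * M) + 27 * t * M * \<epsilon>) + (6 * \<epsilon> + 2 * t * M) / sqrt N"
        by (rule welding_asymptotics(2)[where q = q and \<epsilon> = \<epsilon> and P = P and M = M and t = t and \<delta> = "2 * b\<^sup>2 + t * (e + b * M)" and N = N];
            fact L(1-3) ex q_lip q_le eps P P_lip t_nonneg q_asym N1 cis_in)
      have L_le: "cmod (L (cis \<theta>)) \<le> 1" using wa1 eps by simp
      have "cmod (L (cis \<theta>) + of_real t * p (cis \<theta>) 0) \<le>
         (1 + 3 * sqrt N) * (2 * e * t) + (6 * \<epsilon> + 2 * t * M) / sqrt N"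
      proof -
        have "(1 + 3 * sqrt N) * (2 * b\<^sup>2 + t * (e + b * M) + 27 * t * M * \<epsilon>) \<le> (1 + 3 * sqrt N) * (2 * e * t)"
          by (rule mult_left_mono[OF tot]) (simp add: add_nonneg_nonneg)
        then show ?thesis using wa2 by (simp add: P_def)
      qed
      also have "(6 * \<epsilon> + 2 * t * M) / sqrt N = t * (146 * M / sqrt N)"
        by (simp add: \<epsilon>_def b_def field_simps)
      also have "\<dots> \<le> t * (\<eta> / 4)" using N t by (intro mult_left_mono) auto
      finally have 1: "cmod (L (cis \<theta>) + of_real t * p (cis \<theta>) 0) \<le> (1 + 3 * sqrt N) * (2 * e * t) + t * (\<eta> / 4)"
        by simp
      have 2: "cmod (q (cis (\<psi> t)) + of_real t * p (cis (\<psi> t)) 0) \<le> 2 * e * t"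
      proof -
        have "27 * t * M * \<epsilon> \<ge> 0" using M0 t by (simp add: \<epsilon>_def b_def)
        then show ?thesis using q_asym[OF norm_cis, of "\<psi> t"] tot unfolding P_def by linarith
      qed
      have 3: "cmod (p (cis (\<psi> t)) 0 - p (cis \<theta>) 0) \<le> \<eta> / 4"
      proof -
        have "cmod (p (cis (\<psi> t)) 0 - p (cis \<theta>) 0) \<le> M * cmod (cis (\<psi> t) - cis \<theta>)"
          by (rule p_lip[OF zT]) auto
        also have "\<dots> \<le> M * (\<eta> / (4 * M))"
          using norm_cis_diff_le[of "\<psi> t" \<theta>] elim(4) M0 by (intro mult_left_mono) (auto simp: dist_real_def)
        also have "\<dots> = \<eta> / 4" using M0 by simp
        finally show ?thesis .
      qed
      have "\<psi> t - \<theta> = Im (cnj (L (cis \<theta>)) - q (cis (\<psi> t)))"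
      proof (rule welding_argument)
        show "cis (\<psi> t) * exp (q (cis (\<psi> t))) = cis \<theta> * exp (cnj (L (cis \<theta>)))"
          using bl(1)[of "cis (\<psi> t)"] L(4)[of "cis \<theta>"] elim(1) by simp
        show "\<bar>\<psi> t - \<theta>\<bar> \<le> 1" using elim(4) by (simp add: dist_real_def)
        show "cmod (q (cis (\<psi> t))) \<le> 1" using q_le[OF norm_cis, of "\<psi> t"] eps by simp
      qed (rule L_le)
      \<comment> \<open>Adding \<open>t p\<close> inside the conjugate and subtracting it outside
        yields \<open>t (cnj p - p)\<close>, whose imaginary part is the term -2 t Im p. The last
        summand corrects for \<open>q\<close> being evaluated at \<psi> t instead of
        \<theta>.\<close>
      then have "\<psi> t - \<theta> - 2 * Im (p (cis \<theta>) 0) * t =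
        Im (cnj (L (cis \<theta>) + of_real t * p (cis \<theta>) 0) - (q (cis (\<psi> t)) + of_real t * p (cis (\<psi> t)) 0)
          + of_real t * (p (cis (\<psi> t)) 0 - p (cis \<theta>) 0))"
        by (simp add: algebra_simps)
      also have "\<bar>\<dots>\<bar> \<le> cmod (cnj (L (cis \<theta>) + of_real t * p (cis \<theta>) 0) - (q (cis (\<psi> t)) + of_real t * p (cis (\<psi> t)) 0)
          + of_real t * (p (cis (\<psi> t)) 0 - p (cis \<theta>) 0))"
        by (rule abs_Im_le_cmod)
      also have "\<dots> \<le> cmod (L (cis \<theta>) + of_real t * p (cis \<theta>) 0) + cmod (q (cis (\<psi> t)) + of_real t * p (cis (\<psi> t)) 0)
          + t * cmod (p (cis (\<psi> t)) 0 - p (cis \<theta>) 0)"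
      proof -
        have "cmod (cnj X - Y + of_real t * Z) \<le> cmod X + cmod Y + t * cmod Z" for X Y Z
          using norm_triangle_ineq[of "cnj X - Y" "of_real t * Z"] norm_triangle_ineq4[of "cnj X" Y] t
          by (simp add: norm_mult)
        then show ?thesis .
      qed
      also have "\<dots> \<le> ((1 + 3 * sqrt N) * (2 * e * t) + t * (\<eta> / 4)) + 2 * e * t + t * (\<eta> / 4)"
        using t by (intro add_mono mult_left_mono 1 2 3) auto
      \<comment> \<open>Three quarters of \<eta> are spent: on the real-part errors, on the high
        frequencies, and on the variation of \<open>p\<close> between the two angles.\<close>
      also have "\<dots> = t * (2 * e * (2 + 3 * sqrt N) + \<eta> / 2)" by (simp add: field_simps)
      also have "\<dots> = t * (3 / 4 * \<eta>)" unfolding e(2) by simp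
      also have "\<dots> < t * \<eta>" using t \<eta> by simp
      finally show ?case using t by (simp add: abs_divide divide_less_eq mult.commute)
    qed
  qed
qed

end
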